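(* Let $L\in\{1,2,\ldots\}$. If $\theta\in(0,\pi]$ and the points $x_1,\ldots,x_R\in\mathbb{S}^2$ are $\theta$-separated, i.e. $\langle x_k,x_l\rangle\le\cos\theta$ for all $k\ne l$, then for all complex coefficients $a_l^m$ ($0\le l\le L$, $|m|\le l$), the function $S=\sum_{l=0}^L\sum_{m=-l}^l a_l^m Y_l^m$ satisfies $$\sum_{k=1}^R|S(x_k)|^2\;\le\; D(\theta,L)\cdot\sum_{l=0}^L\sum_{m=-l}^l|a_l^m|^2$$ with the constant $$D(\theta,L):=\left(2\pi\int_{t_{L,L}}^1P_L(t)^2\,dt\right)^{-1}\cdot\frac{1-\cos\frac{\theta}{2}\cdot t_{L,L}+\sin\frac{\theta}{2}\cdot\sqrt{1-t_{L,L}^2}}{1-\cos\frac{\theta}{2}}.$$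
   Context: $\mathbb{S}^2$ is the unit sphere in $\mathbb{R}^3$. $P_L$ denotes the Legendre polynomial of degree $L$, normalized by $P_L(1)=1$; for $L\ge1$, $t_{L,L}$ is the largest zero of $P_L$. $Y_l^m$, $|m|\le l$, $l=0,1,\ldots$, are the standard spherical harmonics, orthonormal in $L^2(\mathbb{S}^2)$ with respect to the rotation invariant surface measure (total mass $4\pi$): in spherical coordinates (polar angle $\vartheta$, azimuth $\varphi$), $Y_l^m(\vartheta,\varphi)=\sqrt{\frac{2l+1}{4\pi}\frac{(l-m)!}{(l+m)!}}\,P_l^m(\cos\vartheta)e^{im\varphi}$, where $P_l^m(t)=\frac{(-1)^{m+l}}{2^l l!}(1-t^2)^{m/2}\frac{d^{m+l}}{dt^{m+l}}(1-t^2)^l$. *)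

theory Defs
  imports "HOL-Analysis.Analysis" "HOL-Computational_Algebra.Polynomial"
begin

text \<open>
  Rodrigues' formula for the Legendre polynomial of degree \<open>l\<close> with value 1 at 1; this is
  \<open>P\<^sub>l\<^sup>0\<close> in the convention of \<open>assoc_legendre\<close> below.
\<close>

definition legendre :: "nat \<Rightarrow> real poly" where
  "legendre l = smult ((-1) ^ l / (2 ^ l * fact l)) ((pderiv ^^ l) ([:1, 0, -1:] ^ l))"

definition largest_zero :: "nat \<Rightarrow> real" where
  "largest_zero l = Max {t. poly (legendre l) t = 0}"

text \<open>
  The associated Legendre function \<open>P\<^sub>l\<^sup>m\<close> on \<open>[-1, 1]\<close>, meant for \<open>\<bar>m\<bar> \<le> l\<close>, so that
  \<open>nat (int l + m)\<close> does not truncate.  The factor \<open>(1 - t\<^sup>2)\<^bsup>m/2\<^esup>\<close> is an integer power of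
  \<open>sqrt (1 - t\<^sup>2)\<close>: at \<open>t = 1\<close> and \<open>t = -1\<close> this is 1 for \<open>m = 0\<close> (where \<open>powr\<close> would
  give 0), and for \<open>m < 0\<close> it is 0, which is the limit of \<open>P\<^sub>l\<^sup>m\<close> there, the derivative having
  a zero of order \<open>-m\<close>.
\<close>

definition assoc_legendre :: "nat \<Rightarrow> int \<Rightarrow> real \<Rightarrow> real" where
  "assoc_legendre l m t =
     (-1) ^ nat (int l + m) / (2 ^ l * fact l) * (sqrt (1 - t\<^sup>2) powi m)
       * poly ((pderiv ^^ nat (int l + m)) ([:1, 0, -1:] ^ l)) t"

definition sph_harm_ang :: "nat \<Rightarrow> int \<Rightarrow> real \<Rightarrow> real \<Rightarrow> complex" where
  "sph_harm_ang l m \<theta> \<phi> =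
     of_real (sqrt ((2 * real l + 1) / (4 * pi) * (fact (nat (int l - m)) / fact (nat (int l + m))))
       * assoc_legendre l m (cos \<theta>)) * exp (\<i> * of_int m * of_real \<phi>)"

definition sph_point :: "real \<Rightarrow> real \<Rightarrow> real ^ 3" where
  "sph_point \<theta> \<phi> = vector [sin \<theta> * cos \<phi>, sin \<theta> * sin \<phi>, cos \<theta>]"

text \<open>
  \<open>Y\<^sub>l\<^sup>m\<close> as a function on the unit sphere of \<open>real ^ 3\<close>.  The particular choice of the azimuth
  is immaterial, including at the poles; see \<open>sph_harm_sph_point\<close>.
\<close>

definition sph_harm :: "nat \<Rightarrow> int \<Rightarrow> real ^ 3 \<Rightarrow> complex" where
  "sph_harm l m x = sph_harm_ang l m (arccos (x $ 3)) (Arg (Complex (x $ 1) (x $ 2)))"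

lemma sph_harm_sph_point:
  assumes "0 \<le> \<theta>" "\<theta> \<le> pi"
  shows "sph_harm l m (sph_point \<theta> \<phi>) = sph_harm_ang l m \<theta> \<phi>"
proof -
  have c: "Complex (sin \<theta> * cos \<phi>) (sin \<theta> * sin \<phi>) = of_real (sin \<theta>) * cis \<phi>"
    by (simp add: complex_eq_iff)
  have coords: "sph_harm l m (sph_point \<theta> \<phi>)
      = sph_harm_ang l m \<theta> (Arg (of_real (sin \<theta>) * cis \<phi>))"
    using assms by (simp add: sph_harm_def sph_point_def arccos_cos c)
  show ?thesis
  proof (cases "sin \<theta> = 0")
    case True
    then have "1 - (cos \<theta>)\<^sup>2 = 0" by (simp add: cos_squared_eq)
    then show ?thesis
      unfolding coords sph_harm_ang_def assoc_legendre_def by (cases "m = 0") simp_all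
  next
    case False
    then have "sin \<theta> > 0" using sin_ge_zero[OF assms] by simp
    then have "cis (Arg (of_real (sin \<theta>) * cis \<phi>)) = cis \<phi>"
      using cis_Arg[of "of_real (sin \<theta>) * cis \<phi>"]
      by (simp add: sgn_mult sgn_of_real sgn_eq norm_mult)
    moreover have "exp (\<i> * of_int m * of_real p) = cis p powi m" for p
      by (simp add: cis_power_int) (simp add: cis_conv_exp mult_ac)
    ultimately show ?thesis
      unfolding coords sph_harm_ang_def by simp
  qed
qed

lemma sph_point_surj:
  assumes "x \<in> sphere 0 1"
  obtains \<theta> \<phi> where "0 \<le> \<theta>" "\<theta> \<le> pi" "x = sph_point \<theta> \<phi>"
proof -
  have n: "(x $ 1)\<^sup>2 + (x $ 2)\<^sup>2 + (x $ 3)\<^sup>2 = 1"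
    using assms by (simp add: norm_vec_def L2_set_def sum_3)
  define z where "z = Complex (x $ 1) (x $ 2)"
  have "(x $ 3)\<^sup>2 \<le> 1" using n by (smt (verit) zero_le_power2)
  then have b: "-1 \<le> x $ 3" "x $ 3 \<le> 1" by (auto simp: abs_square_le_1)
  have "sin (arccos (x $ 3)) = cmod z"
    using b n by (simp add: sin_arccos_abs abs_square_le_1 z_def cmod_def algebra_simps)
  moreover have "of_real (cmod z) * cis (Arg z) = z"
    using rcis_cmod_Arg[of z] by (simp add: rcis_def)
  then have "x $ 1 = cmod z * cos (Arg z)" "x $ 2 = cmod z * sin (Arg z)"
    by (simp_all add: complex_eq_iff z_def)
  ultimately have "x = sph_point (arccos (x $ 3)) (Arg z)"
    using b by (simp add: vec_eq_iff forall_3 sph_point_def)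
  then show thesis using that b by (metis arccos_lbound arccos_ubound)
qed

definition D_const :: "real \<Rightarrow> nat \<Rightarrow> real" where
  "D_const \<theta> L =
     inverse (2 * pi * integral {largest_zero L..1} (\<lambda>t. (poly (legendre L) t)\<^sup>2))
     * ((1 - cos (\<theta> / 2) * largest_zero L + sin (\<theta> / 2) * sqrt (1 - (largest_zero L)\<^sup>2))
        / (1 - cos (\<theta> / 2)))"

end

theory Submission
  imports Defs
begin

text \<open>
  Write \<open>P\<^sub>L\<close> for the Legendre polynomial, \<open>t\<close> for its largest zero and \<open>\<omega> = arccos t\<close>. The kernel
  \<open>g(s) = P\<^sub>L(s)\<close> for \<open>s \<ge> t\<close> and \<open>g(s) = 0\<close> for \<open>s < t\<close> is continuous because \<open>P\<^sub>L(t) = 0\<close>, and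
  the zonal function \<open>y \<mapsto> g(\<langle>x, y\<rangle>)\<close> lives on the cap of angular radius \<open>\<omega>\<close> about \<open>x\<close>. By the
  Funk--Hecke formula (\<open>Funk_Hecke\<close>), convolution with it multiplies every spherical harmonic of
  degree \<open>l\<close> by \<open>\<gamma>\<^sub>l = 2\<pi> \<integral>\<^sub>t\<^sup>1 P\<^sub>L P\<^sub>l\<close>. On \<open>[t, 1]\<close> the polynomials \<open>P\<^sub>0, \<dots>, P\<^sub>L\<close> decrease in
  the degree (\<open>legendre_antimono_degree\<close>, \<open>largest_zero_dominates\<close>), so \<open>\<gamma>\<^sub>l \<ge> \<gamma>\<^sub>L\<close> for \<open>l \<le> L\<close>,
  and \<open>\<gamma>\<^sub>L\<close> is at the same time the squared norm of the kernel. Dividing the coefficients of \<open>S\<close>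
  by \<open>\<gamma>\<^sub>l\<close> thus gives a function \<open>T\<close> with \<open>S(x) = \<integral> g(\<langle>x, y\<rangle>) T(y) dy\<close> and
  \<open>\<parallel>T\<parallel>\<^sup>2 \<le> \<gamma>\<^sub>L\<^bsup>-2\<^esup> \<Sum>\<bar>a\<^sub>l\<^sup>m\<bar>\<^sup>2\<close>.

  With \<open>A = \<Sum>\<bar>S(x\<^sub>k)\<bar>\<^sup>2\<close> and \<open>h(y) = \<Sum> cnj(S(x\<^sub>k)) g(\<langle>x\<^sub>k, y\<rangle>)\<close> this says \<open>A = \<integral> h T\<close>. Only the
  points \<open>x\<^sub>k\<close> within angle \<open>\<omega>\<close> of \<open>y\<close> contribute to \<open>h(y)\<close>. The caps of radius \<open>\<theta>/2\<close> about these
  points are disjoint and lie in the cap of radius \<open>\<theta>/2 + \<omega>\<close> about \<open>y\<close>, so comparing areas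
  (\<open>spherical_packing\<close>) bounds their number by \<open>N = (1 - cos(\<theta>/2 + \<omega>)) / (1 - cos(\<theta>/2))\<close>. Hence
  \<open>\<parallel>h\<parallel>\<^sup>2 \<le> N A \<gamma>\<^sub>L\<close>, and the Cauchy--Schwarz inequality yields \<open>A \<le> N/\<gamma>\<^sub>L \<cdot> \<Sum>\<bar>a\<^sub>l\<^sup>m\<bar>\<^sup>2\<close>; here
  \<open>N/\<gamma>\<^sub>L\<close> is the claimed constant by the addition theorem for the cosine.

  The analysis on the sphere rests on a single computation (\<open>sphere_moment\<close>): for \<open>u \<in> \<complex>\<^sup>3\<close> and
  the bilinear product, \<open>\<integral> (u\<cdot>y)\<^sup>n dy\<close> depends on \<open>u\<cdot>u\<close> only. Such moments replace the rotation
  invariance of the surface measure. Polarising them at a null vector \<open>v\<close> (\<open>v\<cdot>v = 0\<close>) gives the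
  integrals of \<open>(u\<cdot>y)\<^sup>n (v\<cdot>y)\<^sup>l\<close>. By Laplace's formula the functions \<open>Y\<^sub>l\<^sup>m\<close> are the Fourier
  coefficients in \<open>\<alpha>\<close> of \<open>(v\<^sub>\<alpha>\<cdot>y)\<^sup>l\<close> for a circle of null vectors \<open>v\<^sub>\<alpha>\<close> (\<open>null_vec_expansion\<close>),
  hence finite linear combinations of powers of null linear forms, and orthonormality as well as
  the Funk--Hecke formula for polynomial kernels follow from the polarised moments. The theorem of
  Weierstrass extends the latter to continuous kernels.
\<close>

section \<open>Legendre polynomials and their largest zeros\<close>

text \<open>
  The Leibniz rule for a linear factor; it serves both the three-term recurrence and Taylor's
  formula.
\<close>

lemma higher_pderiv_X_mult:
  fixes p :: "'a :: idom poly"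
  shows "(pderiv ^^ Suc n) ([:0, 1:] * p)
       = [:0, 1:] * (pderiv ^^ Suc n) p + smult (of_nat (Suc n)) ((pderiv ^^ n) p)"
proof (induction n)
  case 0
  show ?case by (simp add: pderiv_mult pderiv_pCons)
next
  case (Suc n)
  have "(pderiv ^^ Suc (Suc n)) ([:0, 1:] * p) = pderiv ((pderiv ^^ Suc n) ([:0, 1:] * p))"
    by simp
  also have "\<dots> = pderiv ([:0, 1:] * (pderiv ^^ Suc n) p)
      + pderiv (smult (of_nat (Suc n)) ((pderiv ^^ n) p))"
    by (simp only: Suc pderiv_add)
  also have "\<dots> = [:0, 1:] * (pderiv ^^ Suc (Suc n)) p + (pderiv ^^ Suc n) p
      + smult (of_nat (Suc n)) ((pderiv ^^ Suc n) p)"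
    by (simp only: pderiv_mult pderiv_smult) (simp add: pderiv_pCons)
  also have "\<dots> = [:0, 1:] * (pderiv ^^ Suc (Suc n)) p
      + smult (of_nat (Suc (Suc n))) ((pderiv ^^ Suc n) p)"
    by (simp only: of_nat_Suc[of "Suc n"] smult_add_left smult_1_left add.assoc)
  finally show ?case .
qed

lemma pderiv_power_one_minus_square:
  "pderiv ([:1, 0, -1:] ^ Suc n) = smult (-2 * real (Suc n)) ([:0, 1:] * [:1, 0, -1:] ^ n)"
proof -
  have "pderiv [:1, 0, -1:] = smult (-2) [:0, 1 :: real:]" by (simp add: pderiv_pCons)
  thus ?thesis
    unfolding pderiv_power_Suc
        by (simp only: mult_smult_left mult_smult_right smult_smult mult.commute)
qed
     
text \<open>
  For \<open>w = 1 - x\<^sup>2\<close> one has \<open>(w')\<^sup>2 = 4 - 4w\<close>, so the second derivative of a power of \<open>w\<close> is again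
  a combination of powers of \<open>w\<close>.
\<close>

lemma pderiv2_power_one_minus_square:
  "pderiv (pderiv ([:1, 0, -1:] ^ Suc (Suc n)))
   = smult (-2 * real (n+2) * (2 * real n + 3)) ([:1, 0, -1:] ^ Suc n)
     + smult (4 * real (n+2) * real (n+1)) ([:1, 0, -1:] ^ n)"
proof -
  have "poly (pderiv (pderiv ([:1, 0, -1:] ^ Suc (Suc n)))) x
     = poly (smult (-2 * real (n+2) * (2 * real n + 3)) ([:1, 0, -1:] ^ Suc n)
     + smult (4 * real (n+2) * real (n+1)) ([:1, 0, -1:] ^ n)) x" for x
    unfolding pderiv_power_one_minus_square[of "Suc n"] pderiv_smult pderiv_mult
      pderiv_power_one_minus_square[of n]
    by (simp add: pderiv_pCons algebra_simps)
  thus ?thesis by (simp add: poly_eq_poly_eq_iff[symmetric] fun_eq_iff)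
qed

lemma legendre_0 [simp]: "legendre 0 = 1"
  by (simp add: legendre_def)

lemma legendre_1: "legendre (Suc 0) = [:0, 1:]"
  by (simp add: legendre_def pderiv_pCons)

text \<open>
  Differentiating \<open>(1 - x\<^sup>2)\<^bsup>n+2\<^esup>\<close> once before the remaining \<open>n + 1\<close> derivatives expresses
  \<open>P\<^bsub>n+2\<^esub>\<close> through \<open>P\<^bsub>n+1\<^esub>\<close> and an antiderivative \<open>Q\<close> of it; differentiating twice first expresses
  \<open>P\<^bsub>n+2\<^esub> - P\<^sub>n\<close> through the same \<open>Q\<close>. Eliminating \<open>Q\<close> gives the recurrence.
\<close>

lemma legendre_recurrence:
  "real (n + 2) * poly (legendre (n+2)) x
   = (2 * real n + 3) * x * poly (legendre (n+1)) x - real (n + 1) * poly (legendre n) x"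
proof -
  define w :: "real poly" where "w = [:1, 0, -1:]"
  define c where "c k = (-1) ^ k / (2 ^ k * fact k :: real)" for k :: nat
  have P: "legendre k = smult (c k) ((pderiv ^^ k) (w ^ k))" for k
    by (simp add: legendre_def c_def w_def)
  have cS: "c (Suc k) * (-2 * real (Suc k)) = c k" for k
    by (simp add: c_def fact_Suc divide_simps del: of_nat_Suc)
  \<comment> \<open>\<open>Q\<close> is the value at \<open>x\<close> of an antiderivative of \<open>P\<^bsub>n+1\<^esub>\<close>\<close>
  define Q where "Q = poly (smult (c (n+1)) ((pderiv ^^ n) (w ^ Suc n))) x"
  have "legendre (n+2) = smult (c (n+2)) ((pderiv ^^ Suc n) (pderiv (w ^ Suc (Suc n))))"
    unfolding P by (simp add: funpow_swap1)
  also have "\<dots> = smult (c (n+1)) ((pderiv ^^ Suc n) ([:0,1:] * w ^ Suc n))"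
    unfolding w_def pderiv_power_one_minus_square higher_pderiv_smult smult_smult
    using cS[of "Suc n"] by (simp del: funpow.simps power.simps)
  also have "\<dots> = [:0,1:] * legendre (n+1) + smult (real (n+1)) (smult (c (n+1)) ((pderiv ^^ n) (w
      ^ Suc n)))"
    unfolding higher_pderiv_X_mult P
        by (simp add: smult_add_right mult.commute del: funpow.simps power.simps)
  finally have A: "poly (legendre (n+2)) x = x * poly (legendre (n+1)) x + real (n+1) * Q"
    by (simp add: Q_def)
  have "legendre (n+2) = smult (c (n+2)) ((pderiv ^^ n) (pderiv (pderiv (w ^ Suc (Suc n)))))"
    unfolding P by (simp add: funpow_swap1)
  also have "\<dots> = smult (c (n+2) * (-2 * real (n+2)) * (2 * real n + 3)) ((pderiv ^^ n) (w ^ Suc n))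
       + smult (c (n+2) * (4 * real (n+2) * real (n+1))) ((pderiv ^^ n) (w ^ n))"
    unfolding w_def pderiv2_power_one_minus_square higher_pderiv_smult higher_pderiv_add
      smult_smult smult_add_right by (simp only: mult_ac)
  also have "c (n+2) * (-2 * real (n+2)) = c (n+1)" using cS[of "Suc n"] by simp
  also have "c (n+2) * (4 * real (n+2) * real (n+1)) = c n"
  proof -
    have "c (n+2) * (4 * real (n+2) * real (n+1))
        = (c (n+2) * (-2 * real (n+2))) * (-2 * real (n+1))"
      by (simp del: of_nat_add of_nat_Suc)
    also have "c (n+2) * (-2 * real (n+2)) = c (n+1)" using cS[of "Suc n"] by simp
    also have "c (n+1) * (-2 * real (n+1)) = c n" using cS[of n] by simp
    finally show ?thesis .
  qed
  finally have "legendre (n+2) = smult (c (n+1) * (2 * real n + 3)) ((pderiv ^^ n) (w ^ Suc n))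
      + legendre n"
    by (simp add: P)
  hence B: "poly (legendre (n+2)) x = (2 * real n + 3) * Q + poly (legendre n) x"
    by (simp add: Q_def)
  have "(2 * real n + 3) * poly (legendre (n+2)) x
     = (2 * real n + 3) * x * poly (legendre (n+1)) x + real (n+1) * ((2 * real n + 3) * Q)"
    unfolding A by (simp add: algebra_simps)
  also have "(2 * real n + 3) * Q = poly (legendre (n+2)) x - poly (legendre n) x"
    using B by simp
  finally show ?thesis by (simp add: algebra_simps)
qed

text \<open>
  The recurrence in terms of successive differences: for \<open>x \<le> 1\<close> the differences stay nonpositive
  as long as the polynomials are nonnegative, and for \<open>x \<ge> 1\<close> they stay nonnegative.
\<close>

lemma legendre_difference:
  "real (n + 2) * (poly (legendre (n+2)) x - poly (legendre (n+1)) x)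
   = (2 * real n + 3) * (x - 1) * poly (legendre (n+1)) x
     + real (n + 1) * (poly (legendre (n+1)) x - poly (legendre n) x)"
  using legendre_recurrence[of n x] by (simp add: algebra_simps)

lemma legendre_decreasing_in_degree:
  assumes "x \<le> 1" and "\<And>l. l < L \<Longrightarrow> 0 \<le> poly (legendre l) x" and "n < L"
  shows "poly (legendre (Suc n)) x \<le> poly (legendre n) x"
  using \<open>n < L\<close>
proof (induction n)
  case 0
  show ?case using assms(1) by (simp add: legendre_1)
next
  case (Suc n)
  have "(2 * real n + 3) * ((x - 1) * poly (legendre (n+1)) x) \<le> 0"
    using assms(1) assms(2)[of "n+1"] Suc.prems
    by (intro mult_nonneg_nonpos mult_nonpos_nonneg) auto
  moreover have "real (n+1) * (poly (legendre (n+1)) x - poly (legendre n) x) \<le> 0"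
    using Suc by (intro mult_nonneg_nonpos) auto
  ultimately have "real (n + 2) * (poly (legendre (n+2)) x - poly (legendre (n+1)) x) \<le> 0"
    unfolding legendre_difference by (simp add: mult.assoc)
  thus ?case by (simp add: mult_le_0_iff)
qed

lemma legendre_antimono_degree:
  assumes "x \<le> 1" and "\<And>l. l < L \<Longrightarrow> 0 \<le> poly (legendre l) x" and "l \<le> L"
  shows "poly (legendre L) x \<le> poly (legendre l) x"
proof -
  have "poly (legendre m) x \<le> poly (legendre l) x" if "l \<le> m" "m \<le> L" for m
    using that
  proof (induction m rule: dec_induct)
    case (step n)
    have "poly (legendre (Suc n)) x \<le> poly (legendre n) x"
      by (rule legendre_decreasing_in_degree[of x L]) (use assms step in auto)
    thus ?case using step by simp
  qed simp
  thus ?thesis using assms(3) by blast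
qed

lemma legendre_at_1 [simp]: "poly (legendre n) 1 = 1"
proof -
  have "poly (legendre (Suc n)) 1 = poly (legendre n) 1" for n
  proof (induction n)
    case (Suc n)
    thus ?case using legendre_difference[of n 1] by simp
  qed (simp add: legendre_1)
  thus ?thesis by (induction n) simp_all
qed

lemma legendre_ge_1:
  assumes "1 \<le> x" shows "1 \<le> poly (legendre n) x"
proof -
  have "1 \<le> poly (legendre n) x \<and> poly (legendre n) x \<le> poly (legendre (Suc n)) x" for n
  proof (induction n)
    case 0
    thus ?case using assms by (simp add: legendre_1)
  next
    case (Suc n)
    have "0 \<le> real (n + 2) * (poly (legendre (n+2)) x - poly (legendre (n+1)) x)"
      unfolding legendre_difference using assms Suc
          by (intro add_nonneg_nonneg mult_nonneg_nonneg) auto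
    thus ?case using Suc by (auto simp: zero_le_mult_iff)
  qed
  thus ?thesis by blast
qed

lemma finite_legendre_zeros: "finite {t. poly (legendre l) t = 0}"
  using legendre_at_1[of l] by (intro poly_roots_finite) force

lemma legendre_zero_less_1:
  assumes "poly (legendre l) t = 0" shows "t < 1"
  using legendre_ge_1[of t l] assms by force

text \<open>
  Let \<open>s\<close> be the largest zero of any of \<open>P\<^sub>1, \<dots>, P\<^sub>L\<close>. On \<open>[s, 1]\<close> they are all nonnegative, since
  each equals 1 at 1, and so they decrease in the degree. One of them vanishes at \<open>s\<close>; therefore
  \<open>P\<^sub>L(s) \<le> 0\<close>, and \<open>s\<close> is already a zero of \<open>P\<^sub>L\<close>. This replaces the interlacing of zeros.
\<close>

lemma largest_zero_dominates:
  assumes "1 \<le> L"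
  obtains s where "0 \<le> s" "s < 1" "poly (legendre L) s = 0" "largest_zero L = s"
    "\<And>l x. l \<le> L \<Longrightarrow> s \<le> x \<Longrightarrow> 0 \<le> poly (legendre l) x"
proof -
  define Z where "Z = (\<Union>l\<in>{1..L}. {t. poly (legendre l) t = 0})"
  have fin: "finite Z" unfolding Z_def using finite_legendre_zeros by blast
  have Z0: "0 \<in> Z" using assms by (auto simp: Z_def legendre_1 intro!: bexI[of _ 1])
  define s where "s = Max Z"
  have sZ: "s \<in> Z" using Max_in[OF fin] Z0 by (auto simp: s_def)
  have s0: "0 \<le> s" using Max_ge[OF fin Z0] by (simp add: s_def)
  have s1: "s < 1" using sZ by (auto simp: Z_def intro: legendre_zero_less_1)
  have nonneg: "0 \<le> poly (legendre l) x" if "l \<le> L" "s \<le> x" for l x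
  proof (rule ccontr)
    assume neg: "\<not> 0 \<le> poly (legendre l) x"
    hence "x < 1" using legendre_ge_1[of x l] by force
    then obtain t where t: "x < t" "t < 1" "poly (legendre l) t = 0"
      using poly_IVT_pos[of x 1 "legendre l"] neg by auto
    have "l \<noteq> 0" using neg by (intro notI) simp
    hence "t \<in> Z" using t that by (auto simp: Z_def)
    hence "t \<le> s" using Max_ge[OF fin] by (simp add: s_def)
    thus False using t that by simp
  qed
  obtain l where l: "1 \<le> l" "l \<le> L" "poly (legendre l) s = 0"
    using sZ by (auto simp: Z_def)
  have "poly (legendre L) s \<le> poly (legendre l) s"
    by (rule legendre_antimono_degree) (use s1 l nonneg in auto)
  hence zero: "poly (legendre L) s = 0" using l nonneg[of L s] by simp
  have "largest_zero L = s" unfolding largest_zero_def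
  proof (rule Max_eqI[OF finite_legendre_zeros])
    fix y assume "y \<in> {t. poly (legendre L) t = 0}"
    hence "y \<in> Z" using assms by (auto simp: Z_def)
    thus "y \<le> s" using Max_ge[OF fin] by (simp add: s_def)
  qed (use zero in simp)
  thus ?thesis using that s0 s1 zero nonneg by blast
qed

section \<open>Integration over the sphere\<close>

lemma sph_point_in_sphere: "sph_point \<theta> \<phi> \<in> sphere 0 1"
proof -
  have "(sin \<theta> * cos \<phi>)\<^sup>2 + (sin \<theta> * sin \<phi>)\<^sup>2 + (cos \<theta>)\<^sup>2
      = (sin \<theta>)\<^sup>2 * ((cos \<phi>)\<^sup>2 + (sin \<phi>)\<^sup>2) + (cos \<theta>)\<^sup>2"
    by (simp only: power_mult_distrib distrib_left)
  thus ?thesis by (simp add: norm_vec_def L2_set_def sum_3 sph_point_def)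
qed

lemma continuous_on_sph_point:
  "continuous_on S (\<lambda>p. sph_point (fst p) (snd p))"
proof -
  have "sph_point (fst p) (snd p) = (\<chi> i. if i = 1 then sin (fst p) * cos (snd p) else
       if i = 2 then sin (fst p) * sin (snd p) else cos (fst p))" for p
    by (auto simp: sph_point_def vec_eq_iff forall_3)
  moreover have "continuous_on S (\<lambda>p. \<chi> i::3. if i = 1 then sin (fst p) * cos (snd p) else
       if i = 2 then sin (fst p) * sin (snd p) else cos (fst p))"
  proof (rule continuous_on_vec_lambda)
    fix i :: 3
    show "continuous_on S (\<lambda>p. if i = 1 then sin (fst p) * cos (snd p) else
       if i = 2 then sin (fst p) * sin (snd p) else cos (fst p))"
      by (cases "i = 1"; cases "i = 2"; simp; intro continuous_intros)
  qed
  ultimately show ?thesis by simp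
qed

text \<open>
  The surface integral in spherical coordinates, of total mass \<open>4\<pi>\<close>. It is meant for continuous
  functions, for which it is also an integral over a rectangle, and is positive and linear.
\<close>

definition sphere_integral :: "(real ^ 3 \<Rightarrow> 'a :: banach) \<Rightarrow> 'a" where
  "sphere_integral f =
     integral {0..pi} (\<lambda>\<theta>. integral {-pi..pi} (\<lambda>\<phi>. sin \<theta> *\<^sub>R f (sph_point \<theta> \<phi>)))"

lemma sphere_integral_box:
  fixes f :: "real ^ 3 \<Rightarrow> 'a :: banach"
  assumes "continuous_on (sphere 0 1) f"
  shows "((\<lambda>p. sin (fst p) *\<^sub>R f (sph_point (fst p) (snd p))) has_integral sphere_integral f)
           (cbox (0, -pi) (pi, pi))"
proof -
  let ?F = "\<lambda>p. sin (fst p) *\<^sub>R f (sph_point (fst p) (snd p))"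
  have c: "continuous_on (cbox (0, -pi) (pi, pi)) ?F"
  proof -
    have "continuous_on (cbox (0, -pi) (pi, pi)) (\<lambda>p. f (sph_point (fst p) (snd p)))"
      by (rule continuous_on_compose2[OF assms continuous_on_sph_point]) (use sph_point_in_sphere
          in blast)
    thus ?thesis by (intro continuous_on_scaleR continuous_intros)
  qed
  have "integral (cbox (0, -pi) (pi, pi)) ?F = sphere_integral f"
    unfolding integral_prod_continuous[OF c] sphere_integral_def by simp
  thus ?thesis using integrable_integral[OF integrable_continuous[OF c]] by simp
qed

lemma sphere_integral_unique:
  fixes f :: "real ^ 3 \<Rightarrow> 'a :: banach"
  assumes "continuous_on (sphere 0 1) f"
    and "((\<lambda>p. sin (fst p) *\<^sub>R f (sph_point (fst p) (snd p))) has_integral I) (cbox (0, -pi) (pi,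
        pi))"
  shows "sphere_integral f = I"
  using sphere_integral_box[OF assms(1)] assms(2) has_integral_unique by blast

lemma sphere_integral_cong:
  assumes "\<And>y. y \<in> sphere 0 1 \<Longrightarrow> f y = g y"
  shows "sphere_integral f = sphere_integral g"
  unfolding sphere_integral_def using assms[OF sph_point_in_sphere] by simp

lemma sphere_integral_add:
  fixes f g :: "real ^ 3 \<Rightarrow> 'a :: banach"
  assumes "continuous_on (sphere 0 1) f" "continuous_on (sphere 0 1) g"
  shows "sphere_integral (\<lambda>y. f y + g y) = sphere_integral f + sphere_integral g"
  by (rule sphere_integral_unique)
     (use has_integral_add[OF sphere_integral_box[OF assms(1)] sphere_integral_box[OF assms(2)]]
          assms in \<open>auto intro!: continuous_intros simp: scaleR_add_right\<close>)

lemma sphere_integral_linear: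
  fixes f :: "real ^ 3 \<Rightarrow> 'a :: banach" and h :: "'a \<Rightarrow> 'b :: banach"
  assumes "continuous_on (sphere 0 1) f" "bounded_linear h"
  shows "sphere_integral (\<lambda>y. h (f y)) = h (sphere_integral f)"
proof (rule sphere_integral_unique)
  show "continuous_on (sphere 0 1) (\<lambda>y. h (f y))"
    using assms bounded_linear.continuous_on by blast
  have "(h \<circ> (\<lambda>p. sin (fst p) *\<^sub>R f (sph_point (fst p) (snd p)))) =
     (\<lambda>p. sin (fst p) *\<^sub>R h (f (sph_point (fst p) (snd p))))"
    by (auto simp: fun_eq_iff linear_simps[OF assms(2)])
  thus "((\<lambda>p. sin (fst p) *\<^sub>R h (f (sph_point (fst p) (snd p)))) has_integral h (sphere_integral f))
           (cbox (0, -pi) (pi, pi))"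
    using has_integral_linear[OF sphere_integral_box[OF assms(1)] assms(2)] by metis
qed

lemma sphere_integral_mult_left:
  fixes f :: "real ^ 3 \<Rightarrow> 'a :: {banach, real_normed_algebra}"
  assumes "continuous_on (sphere 0 1) f"
  shows "sphere_integral (\<lambda>y. c * f y) = c * sphere_integral f"
  by (rule sphere_integral_linear[OF assms bounded_linear_mult_right])

lemma sphere_integral_sum:
  fixes f :: "'i \<Rightarrow> real ^ 3 \<Rightarrow> 'a :: banach"
  assumes "\<And>i. i \<in> A \<Longrightarrow> continuous_on (sphere 0 1) (f i)"
  shows "sphere_integral (\<lambda>y. \<Sum>i\<in>A. f i y) = (\<Sum>i\<in>A. sphere_integral (f i))"
  using assms
proof (induction A rule: infinite_finite_induct)
  case (insert i A)
  thus ?case by (simp add: sphere_integral_add continuous_on_sum)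
qed (simp_all add: sphere_integral_def)

lemma sphere_integral_mono:
  fixes f g :: "real ^ 3 \<Rightarrow> real"
  assumes "continuous_on (sphere 0 1) f" "continuous_on (sphere 0 1) g"
    and "\<And>y. y \<in> sphere 0 1 \<Longrightarrow> f y \<le> g y"
  shows "sphere_integral f \<le> sphere_integral g"
  by (rule has_integral_le[OF sphere_integral_box[OF assms(1)] sphere_integral_box[OF assms(2)]])
     (auto intro!: mult_left_mono assms(3) sph_point_in_sphere sin_ge_zero)

text \<open>
  The crude constant \<open>2\<pi>\<^sup>2\<close>, the area of the parameter rectangle, suffices for continuity in the
  uniform norm.
\<close>

lemma sphere_integral_norm_le:
  fixes f :: "real ^ 3 \<Rightarrow> 'a :: banach"
  assumes "continuous_on (sphere 0 1) f" "\<And>y. y \<in> sphere 0 1 \<Longrightarrow> norm (f y) \<le> B"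
  shows "norm (sphere_integral f) \<le> B * (2 * pi\<^sup>2)"
proof -
  have B: "0 \<le> B" using assms(2)[OF sph_point_in_sphere] norm_ge_zero order_trans by blast
  have "norm (sphere_integral f) \<le> B * Henstock_Kurzweil_Integration.content (cbox (0, -pi) (pi,
      pi :: real))"
  proof (rule has_integral_bound[OF B sphere_integral_box[OF assms(1)]])
    fix p :: "real \<times> real"
    have "\<bar>sin (fst p)\<bar> * norm (f (sph_point (fst p) (snd p))) \<le> 1 * B"
      using B assms(2)[OF sph_point_in_sphere] by (intro mult_mono) auto
    thus "norm (sin (fst p) *\<^sub>R f (sph_point (fst p) (snd p))) \<le> B" by simp
  qed
  thus ?thesis by (simp add: content_Pair[of 0 "-pi" pi pi] power2_eq_square)
qed

lemma has_integral_exp_int: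
  "((\<lambda>\<phi>. exp (\<i> * of_int k * of_real \<phi>)) has_integral (if k
      = 0 then of_real (2 * pi) else 0)) {-pi..pi}"
proof (cases "k = 0")
  case True
  thus ?thesis using has_integral_const_real[of "1::complex" "-pi" pi]
      by (simp add: scaleR_conv_of_real)
next
  case False
  let ?F = "\<lambda>\<phi>. exp (\<i> * of_int k * of_real \<phi>) / (\<i> * of_int k)"
  have "((\<lambda>\<phi>. exp (\<i> * of_int k * of_real \<phi>)) has_integral ?F pi - ?F (-pi)) {-pi..pi}"
    using False
    by (intro fundamental_theorem_of_calculus has_vector_derivative_real_field)
       (auto intro!: derivative_eq_intros)
  moreover have "exp (\<i> * of_int k * of_real pi) = exp (\<i> * of_int k * of_real (-pi))"
  proof -
    have "exp (\<i> * of_int k * of_real pi)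
        = exp (\<i> * of_int k * of_real (-pi)) * exp (2 * of_int k * of_real pi * \<i>)"
      by (subst exp_add [symmetric]) (simp add: algebra_simps)
    also have "exp (2 * of_int k * of_real pi * \<i>) = 1"
      using exp_integer_2pi[of "of_int k"] by (simp add: mult_ac)
    finally show ?thesis by simp
  qed
  ultimately show ?thesis using False by simp
qed

lemma sum_even_indices:
  fixes f :: "nat \<Rightarrow> 'a :: comm_monoid_add"
  shows "(\<Sum>j\<le>n. if even j then f j else 0) = (\<Sum>k\<le>n div 2. f (2 * k))"
proof -
  have "(\<Sum>k\<le>n div 2. f (2 * k)) = (\<Sum>j\<in>(\<lambda>k. 2 * k) ` {..n div 2}. f j)"
    by (subst sum.reindex) (auto simp: inj_on_def)
  also have "(\<lambda>k. 2 * k) ` {..n div 2} = {j. j \<le> n \<and> even j}"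
    by (auto elim!: evenE)
  also have "(\<Sum>j | j \<le> n \<and> even j. f j) = (\<Sum>j\<in>{..n} \<inter> {j. even j}. f j)"
    by (rule sum.cong) auto
  also have "\<dots> = (\<Sum>j\<le>n. if even j then f j else 0)"
    by (subst sum.inter_restrict) auto
  finally show ?thesis by simp
qed

text \<open>
  Writing \<open>A cos \<phi> + B sin \<phi> = p e\<^bsup>i\<phi>\<^esup> + q e\<^bsup>-i\<phi>\<^esup>\<close> with \<open>pq = (A\<^sup>2 + B\<^sup>2)/4\<close> and expanding, only
  the terms with equally many factors \<open>p\<close> and \<open>q\<close> survive the integration. The result depends on
  \<open>A\<close> and \<open>B\<close> through \<open>A\<^sup>2 + B\<^sup>2\<close> only, which is the rotation invariance about the polar axis.
\<close>

lemma has_integral_circle_power: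
  fixes A B C :: complex
  shows "((\<lambda>\<phi>. (A * of_real (cos \<phi>) + B * of_real (sin \<phi>) + C) ^ n) has_integral
     (\<Sum>k\<le>n div 2. of_real (2 * pi) * of_nat (n choose (2 * k)) * of_nat ((2 * k) choose k)
        * ((A\<^sup>2 + B\<^sup>2) / 4) ^ k * C ^ (n - 2 * k))) {-pi..pi}"
proof -
  \<comment> \<open>the coefficients of \<open>e\<^bsup>i\<phi>\<^esup>\<close> and \<open>e\<^bsup>-i\<phi>\<^esup>\<close>\<close>
  define p q where "p = (A - \<i> * B) / 2" and "q = (A + \<i> * B) / 2"
  have pq: "p * q = (A\<^sup>2 + B\<^sup>2) / 4"
    by (simp add: p_def q_def field_simps power2_eq_square)
  define e where "e k \<phi> = exp (\<i> * of_int k * of_real \<phi>)" for k :: int and \<phi> :: real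
  have e_eq: "e k \<phi> = cis (of_int k * \<phi>)" for k \<phi>
    by (simp add: e_def cis_conv_exp mult_ac)
  have base: "A * of_real (cos \<phi>) + B * of_real (sin \<phi>) = p * e 1 \<phi> + q * e (-1) \<phi>" for \<phi>
    by (simp add: e_eq p_def q_def complex_eq_iff field_simps)
  have expand: "(A * of_real (cos \<phi>) + B * of_real (sin \<phi>) + C) ^ n
      = (\<Sum>j\<le>n. \<Sum>i\<le>j. of_nat (n choose j) * of_nat (j choose i) * p ^ i * q ^ (j - i) * C ^ (n - j)
          * e (2 * int i - int j) \<phi>)" for \<phi>
  proof -
    have e: "e 1 \<phi> ^ i * e (-1) \<phi> ^ (j - i) = e (2 * int i - int j) \<phi>" if "i \<le> j" for i j
    proof -
      have "e 1 \<phi> ^ i * e (-1) \<phi> ^ (j - i) = cis (real i * \<phi> - real (j - i) * \<phi>)"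
        by (simp add: e_eq Complex.DeMoivre cis_mult)
      also have "real i * \<phi> - real (j - i) * \<phi> = of_int (2 * int i - int j) * \<phi>"
        using that by (simp add: of_nat_diff algebra_simps)
      finally show ?thesis by (simp add: e_eq)
    qed
    have "(A * of_real (cos \<phi>) + B * of_real (sin \<phi>) + C) ^ n
        = (\<Sum>j\<le>n. of_nat (n choose j) * (p * e 1 \<phi> + q * e (-1) \<phi>) ^ j * C ^ (n - j))"
      unfolding base by (rule binomial_ring)
    also have "\<dots> = (\<Sum>j\<le>n. \<Sum>i\<le>j. of_nat (n choose j) *
         (of_nat (j choose i) * (p * e 1 \<phi>) ^ i * (q * e (-1) \<phi>) ^ (j - i)) * C ^ (n - j))"
      by (simp add: binomial_ring[of "p * e 1 \<phi>"] sum_distrib_left sum_distrib_right)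
    also have "\<dots> = (\<Sum>j\<le>n. \<Sum>i\<le>j. of_nat (n choose j) * of_nat (j choose i) * p ^ i * q ^ (j - i)
        * C ^ (n - j)
          * (e 1 \<phi> ^ i * e (-1) \<phi> ^ (j - i)))"
      by (simp add: power_mult_distrib mult_ac)
    also have "\<dots> = (\<Sum>j\<le>n. \<Sum>i\<le>j. of_nat (n choose j) * of_nat (j choose i) * p ^ i * q ^ (j - i)
        * C ^ (n - j)
          * e (2 * int i - int j) \<phi>)"
      by (intro sum.cong refl) (simp add: e)
    finally show ?thesis .
  qed
  have "((\<lambda>\<phi>. (A * of_real (cos \<phi>) + B * of_real (sin \<phi>) + C) ^ n) has_integral
      (\<Sum>j\<le>n. \<Sum>i\<le>j. of_nat (n choose j) * of_nat (j choose i) * p ^ i * q ^ (j - i) * C ^ (n - j)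
          * (if 2 * int i - int j = 0 then of_real (2 * pi) else 0))) {-pi..pi}"
    unfolding expand e_def
    by (intro has_integral_sum finite_atMost has_integral_mult_right has_integral_exp_int)
  also have "(\<Sum>j\<le>n. \<Sum>i\<le>j. of_nat (n choose j) * of_nat (j choose i) * p ^ i * q ^ (j - i)
      * C ^ (n - j)
          * (if 2 * int i - int j = 0 then of_real (2 * pi) else 0))
      = (\<Sum>j\<le>n. if even j then of_nat (n choose j) * of_nat (j choose (j div 2)) * (p
          * q) ^ (j div 2) * C ^ (n - j)
          * of_real (2 * pi) else 0)" (is "_ = ?R")
  proof (rule sum.cong[OF refl])
    fix j
    show "(\<Sum>i\<le>j. of_nat (n choose j) * of_nat (j choose i) * p ^ i * q ^ (j - i) * C ^ (n - j)
          * (if 2 * int i - int j = 0 then of_real (2 * pi) else 0))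
      = (if even j then of_nat (n choose j) * of_nat (j choose (j div 2)) * (p * q) ^ (j div 2)
          * C ^ (n - j)
          * of_real (2 * pi) else 0)"
    proof (cases "even j")
      case True
      then obtain k where k: "j = 2 * k" by (elim evenE)
      have eq: "(2 * int i - int j = 0) = (i = k)" for i using k by auto
      have "(\<Sum>i\<le>j. of_nat (n choose j) * of_nat (j choose i) * p ^ i * q ^ (j - i) * C ^ (n - j)
          * (if 2 * int i - int j = 0 then of_real (2 * pi) else 0))
        = (\<Sum>i\<le>j. if i = k then of_nat (n choose j) * of_nat (j choose k) * p ^ k * q ^ (j - k)
            * C ^ (n - j)
          * of_real (2 * pi) else 0)"
        unfolding eq by (intro sum.cong refl) simp
      also have "\<dots> = of_nat (n choose j) * of_nat (j choose k) * p ^ k * q ^ (j - k) * C ^ (n - j)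
          * of_real (2 * pi)"
        by (subst sum.delta) (simp_all add: k)
      also have "\<dots> = of_nat (n choose j) * of_nat (j choose k) * (p * q) ^ k * C ^ (n - j)
          * of_real (2 * pi)"
        by (simp add: k power_mult_distrib)
      finally show ?thesis by (simp add: k)
    next
      case False
      have "2 * int i - int j \<noteq> 0" for i using False by presburger
      thus ?thesis using False by simp
    qed
  qed
  also have "?R = (\<Sum>k\<le>n div 2. of_nat (n choose (2*k)) * of_nat ((2*k) choose k) * (p * q) ^ k
      * C ^ (n - 2*k)
          * of_real (2 * pi))"
    by (subst sum_even_indices) simp
  also have "\<dots> = (\<Sum>k\<le>n div 2. of_real (2 * pi) * of_nat (n choose (2 * k)) * of_nat ((2
      * k) choose k)
        * ((A\<^sup>2 + B\<^sup>2) / 4) ^ k * C ^ (n - 2 * k))"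
    by (simp add: pq mult_ac)
  finally show ?thesis .
qed

text \<open>
  Integration by parts: the derivative of \<open>sin\<^bsup>2k+2\<^esup> \<theta> cos\<^bsup>e+1\<^esup> \<theta>\<close> integrates to 0.
\<close>

lemma has_integral_sin_cos_step:
  fixes k e :: nat
  assumes "((\<lambda>\<theta>. sin \<theta> ^ (2 * k + 1) * cos \<theta> ^ (e + 2)) has_integral I) {0..pi}"
  shows "((\<lambda>\<theta>. sin \<theta> ^ (2 * Suc k + 1) * cos \<theta> ^ e) has_integral (2 * real (k + 1) / real (e + 1)
      * I)) {0..pi}"
proof -
  let ?F = "\<lambda>\<theta>. sin \<theta> ^ (2 * k + 2) * cos \<theta> ^ (e + 1)"
  let ?F' = "\<lambda>\<theta>. 2 * real (k + 1) * (sin \<theta> ^ (2 * k + 1) * cos \<theta> ^ (e + 2)) -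
      real (e + 1) * (sin \<theta> ^ (2 * Suc k + 1) * cos \<theta> ^ e)"
  have "(?F has_real_derivative ?F' \<theta>) (at \<theta> within {0..pi})" for \<theta>
    by (rule derivative_eq_intros refl)+ (simp add: algebra_simps)
  hence "(?F' has_integral ?F pi - ?F 0) {0..pi}"
    by (intro fundamental_theorem_of_calculus) (auto
        simp: has_real_derivative_iff_has_vector_derivative)
  from has_integral_diff[OF has_integral_mult_right[OF assms, of "2 * real (k + 1)"] this]
  have "((\<lambda>\<theta>. real (e + 1) * (sin \<theta> ^ (2 * Suc k + 1) * cos \<theta> ^ e)) has_integral 2 * real (k + 1)
      * I) {0..pi}"
    by simp
  from has_integral_mult_right[OF this, of "1 / real (e + 1)"]
  show ?thesis by (simp add: field_simps del: of_nat_add of_nat_Suc)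
qed

lemma has_integral_sin_cos_power:
  "((\<lambda>\<theta>. sin \<theta> * cos \<theta> ^ e) has_integral (1 - (-1) ^ (e + 1)) / real (e + 1)) {0..pi}"
proof -
  let ?F = "\<lambda>\<theta>. - (cos \<theta> ^ (e + 1)) / real (e + 1)"
  have "(?F has_real_derivative sin \<theta> * cos \<theta> ^ e) (at \<theta> within {0..pi})" for \<theta>
    by (rule derivative_eq_intros refl | simp)+
  hence "((\<lambda>\<theta>. sin \<theta> * cos \<theta> ^ e) has_integral ?F pi - ?F 0) {0..pi}"
    by (intro fundamental_theorem_of_calculus) (auto
        simp: has_real_derivative_iff_has_vector_derivative)
  thus ?thesis by (simp add: field_simps)
qed

lemma has_integral_sin_odd_cos_odd:
  assumes "odd e"
  shows "((\<lambda>\<theta>. sin \<theta> ^ (2 * k + 1) * cos \<theta> ^ e) has_integral 0) {0..pi}"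
  using assms
proof (induction k arbitrary: e)
  case 0
  thus ?case using has_integral_sin_cos_power[of e] by simp
next
  case (Suc k)
  show ?case using has_integral_sin_cos_step[OF Suc.IH[of "e+2"]] Suc.prems by simp
qed

lemma has_integral_sin_odd_cos_even:
  "((\<lambda>\<theta>. sin \<theta> ^ (2 * k + 1) * cos \<theta> ^ (2 * j)) has_integral
      2 * 4 ^ k * fact (j + k) * fact k * fact (2 * j) / (fact j * fact (2 * j + 2 * k
          + 1))) {0..pi}"
proof (induction k arbitrary: j)
  case 0
  have "2 * 4 ^ 0 * fact (j + 0) * fact 0 * fact (2 * j) / (fact j * fact (2 * j + 2 * 0 + 1))
      = (1 - (-1) ^ (2 * j + 1)) / real (2 * j + 1)"
    by (simp add: divide_simps)
  thus ?case using has_integral_sin_cos_power[of "2 * j"]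
      by (simp only: mult_0_right add_0_left power_one_right)
next
  case (Suc k)
  have "2 * real (k + 1) / real (2 * j + 1) *
      (2 * 4 ^ k * fact (Suc j + k) * fact k * fact (2 * Suc j) / (fact (Suc j) * fact (2 * Suc j
          + 2 * k + 1)))
    = 2 * 4 ^ Suc k * fact (j + Suc k) * fact (Suc k) * fact (2 * j) / (fact j * fact (2 * j + 2
        * Suc k + 1))"
  proof -
    have 1: "(fact (2 * Suc j) :: real) = (2 * real j + 2) * (2 * real j + 1) * fact (2 * j)"
      by (simp add: algebra_simps)
    have 2: "(fact (Suc j) :: real) = (real j + 1) * fact j" by (simp add: algebra_simps)
    have 3: "(fact (Suc k) :: real) = (real k + 1) * fact k" by (simp add: algebra_simps)
    have 4: "2 * Suc j + 2 * k + 1 = 2 * j + 2 * Suc k + 1" "Suc j + k = j + Suc k" by simp_all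
    have 5: "2 * real j + 1 \<noteq> 0" "real j + 1 \<noteq> 0" by linarith+
    define a b c d e where "a = (fact (2 * j) :: real)" and "b = (fact j :: real)"
      and "c = (fact k :: real)" and "d = (fact (2 * j + 2 * Suc k + 1) :: real)"
      and "e = (fact (j + Suc k) :: real)"
    have nz: "b \<noteq> 0" "d \<noteq> 0" by (simp_all add: b_def d_def)
    have 6: "real (2 * j + 1) = 2 * real j + 1" "real (k + 1) = real k + 1" by simp_all
    show ?thesis unfolding 1 2 3 4 6 a_def[symmetric] b_def[symmetric] c_def[symmetric]
        d_def[symmetric] e_def[symmetric]
      using 5 nz by (simp add: divide_simps) (simp add: algebra_simps)
  qed
  moreover have e: "2 * Suc j = 2 * j + 2" by simp
  have "((\<lambda>\<theta>. sin \<theta> ^ (2 * k + 1) * cos \<theta> ^ (2 * j + 2)) has_integral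
      2 * 4 ^ k * fact (Suc j + k) * fact k * fact (2 * Suc j) / (fact (Suc j) * fact (2 * Suc j
          + 2 * k + 1))) {0..pi}"
    using Suc.IH[of "Suc j"] unfolding e .
  from has_integral_sin_cos_step[OF this]
  have "((\<lambda>\<theta>. sin \<theta> ^ (2 * Suc k + 1) * cos \<theta> ^ (2 * j)) has_integral
      2 * real (k + 1) / real (2 * j + 1) * (2 * 4 ^ k * fact (Suc j + k) * fact k * fact (2
          * Suc j) / (fact (Suc j) * fact (2 * Suc j + 2 * k + 1)))) {0..pi}" .
  ultimately show ?case by (simp only:)
qed

section \<open>Moments of powers of linear forms\<close>

text \<open>
  The product is bilinear, not Hermitian: nonzero vectors \<open>v\<close> with \<open>v\<cdot>v = 0\<close> exist, and for these
  the polynomial \<open>(v\<cdot>y)\<^sup>l\<close> is harmonic.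
\<close>

definition cdot :: "complex ^ 3 \<Rightarrow> complex ^ 3 \<Rightarrow> complex" where
  "cdot u v = (\<Sum>i\<in>UNIV. u $ i * v $ i)"

definition cvec :: "real ^ 3 \<Rightarrow> complex ^ 3" where
  "cvec x = (\<chi> i. of_real (x $ i))"

lemma cdot_commute: "cdot u v = cdot v u"
  by (simp add: cdot_def mult.commute)

lemma cdot_cvec: "cdot (cvec x) (cvec y) = of_real (x \<bullet> y)"
  by (simp add: cdot_def cvec_def inner_vec_def)

lemma cdot_add_smult_left: "cdot (u + t *s v) w = cdot u w + t * cdot v w"
  by (simp add: cdot_def sum_distrib_left sum.distrib distrib_right mult.assoc)

lemma cdot_add_smult_right: "cdot w (u + t *s v) = cdot w u + t * cdot w v"
  by (simp add: cdot_commute[of w] cdot_add_smult_left)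

lemma continuous_on_cdot_cvec [continuous_intros]: "continuous_on S (\<lambda>y. cdot u (cvec y))"
  unfolding cdot_def cvec_def by (auto intro!: continuous_intros)

text \<open>
  The constants from the integration over the azimuth, times those from the integration over the
  polar angle, are the coefficients of a binomial expansion.
\<close>

lemma beta_binomial_identity:
  fixes k N :: nat
  assumes "k \<le> N"
  shows "real (2 * N choose (2 * k)) * real (2 * k choose k) *
     (2 * 4 ^ k * fact (N - k + k) * fact k * fact (2 * (N - k)) / (fact (N - k) * fact (2
         * (N - k) + 2 * k + 1)))
     = 4 ^ k * 2 / real (2 * N + 1) * real (N choose k)"
proof -
  have 1: "real (2 * N choose (2 * k)) = fact (2 * N) / (fact (2 * k) * fact (2 * (N - k)))"
    using assms by (subst binomial_fact) (auto simp: diff_mult_distrib2)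
  have 2: "real (2 * k choose k) = fact (2 * k) / (fact k * fact k)"
    by (subst binomial_fact) auto
  have 3: "real (N choose k) = fact N / (fact k * fact (N - k))"
    using assms by (subst binomial_fact) auto
  have 4: "N - k + k = N" "2 * (N - k) + 2 * k + 1 = Suc (2 * N)" using assms by simp_all
  have 5: "real (2 * N + 1) = real (Suc (2 * N))" by simp
  show ?thesis unfolding 1 2 3 4 5 fact_Suc
    by (simp add: divide_simps del: of_nat_Suc)
qed

text \<open>
  Integrating out the azimuth leaves a polynomial in \<open>Q = u\<^sub>1\<^sup>2 + u\<^sub>2\<^sup>2\<close> and \<open>u\<^sub>3\<close>, and the
  integral over the polar angle turns its coefficients into those of \<open>(Q + u\<^sub>3\<^sup>2)\<^bsup>n/2\<^esup>\<close>. This is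
  the only place where an integral over the sphere is evaluated for an arbitrary direction, and
  what it expresses is the rotation invariance of the surface measure, continued to complex
  directions.
\<close>

lemma sphere_moment:
  "sphere_integral (\<lambda>y. cdot u (cvec y) ^ n) =
     (if even n then of_real (4 * pi / real (n + 1)) * cdot u u ^ (n div 2) else 0)"
proof -
  define Q where "Q = (u $ 1)\<^sup>2 + (u $ 2)\<^sup>2"
  define c where "c k = of_real (2 * pi) * of_nat (n choose (2 * k)) * of_nat ((2 * k) choose k)
        * (Q / 4) ^ k * (u $ 3) ^ (n - 2 * k)" for k
  have inner: "integral {-pi..pi} (\<lambda>\<phi>. sin \<theta> *\<^sub>R cdot u (cvec (sph_point \<theta> \<phi>)) ^ n)
      = (\<Sum>k\<le>n div 2. c k * of_real (sin \<theta> ^ (2 * k + 1) * cos \<theta> ^ (n - 2 * k)))" for \<theta>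
  proof (rule integral_unique)
    let ?A = "u $ 1 * of_real (sin \<theta>)" and ?B = "u $ 2 * of_real (sin \<theta>)" and ?C
        = "u $ 3 * of_real (cos \<theta>)"
    have cd: "cdot u (cvec (sph_point \<theta> \<phi>))
        = ?A * of_real (cos \<phi>) + ?B * of_real (sin \<phi>) + ?C" for \<phi>
      by (simp add: cdot_def cvec_def sum_3 sph_point_def)
    have "((\<lambda>\<phi>. sin \<theta> *\<^sub>R cdot u (cvec (sph_point \<theta> \<phi>)) ^ n) has_integral
        sin \<theta> *\<^sub>R (\<Sum>k\<le>n div 2. of_real (2 * pi) * of_nat (n choose (2 * k)) * of_nat ((2
            * k) choose k)
        * ((?A\<^sup>2 + ?B\<^sup>2) / 4) ^ k * ?C ^ (n - 2 * k))) {-pi..pi}"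
      unfolding cd by (intro has_integral_cmul has_integral_circle_power)
    also have "(?A\<^sup>2 + ?B\<^sup>2) / 4 = Q / 4 * of_real (sin \<theta> ^ 2)"
      by (simp add: Q_def power_mult_distrib field_simps)
    also have "sin \<theta> *\<^sub>R (\<Sum>k\<le>n div 2. of_real (2 * pi) * of_nat (n choose (2 * k)) * of_nat ((2
        * k) choose k)
        * (Q / 4 * of_real (sin \<theta> ^ 2)) ^ k * ?C ^ (n - 2 * k))
       = (\<Sum>k\<le>n div 2. c k * of_real (sin \<theta> ^ (2 * k + 1) * cos \<theta> ^ (n - 2 * k)))"
    proof -
      have "(Q / 4 * of_real (sin \<theta> ^ 2)) ^ k = (Q / 4) ^ k * of_real (sin \<theta> ^ (2 * k))" for k
        by (simp only: power_mult_distrib of_real_power power_mult)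
      thus ?thesis unfolding c_def scaleR_sum_right
        by (intro sum.cong refl) (simp add: scaleR_conv_of_real power_mult_distrib mult_ac)
    qed
    finally show "((\<lambda>\<phi>. sin \<theta> *\<^sub>R cdot u (cvec (sph_point \<theta> \<phi>)) ^ n) has_integral
       (\<Sum>k\<le>n div 2. c k * of_real (sin \<theta> ^ (2 * k + 1) * cos \<theta> ^ (n - 2 * k)))) {-pi..pi}" .
  qed
  have outer: "sphere_integral (\<lambda>y. cdot u (cvec y) ^ n) = (\<Sum>k\<le>n div 2. c k * of_real (b k))"
    if "\<And>k. k \<le> n div 2 \<Longrightarrow> ((\<lambda>\<theta>. sin \<theta> ^ (2 * k + 1) * cos \<theta> ^ (n - 2
        * k)) has_integral b k) {0..pi}" for b
    unfolding sphere_integral_def inner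
  proof (intro integral_unique has_integral_sum finite_atMost has_integral_mult_right)
    fix k assume "k \<in> {..n div 2}"
    hence "((\<lambda>\<theta>. sin \<theta> ^ (2 * k + 1) * cos \<theta> ^ (n - 2 * k)) has_integral b k) {0..pi}"
      using that by simp
    from has_integral_linear[OF this bounded_linear_of_real[where ?'a = complex]]
    show "((\<lambda>\<theta>. complex_of_real (sin \<theta> ^ (2 * k + 1) * cos \<theta> ^ (n - 2
        * k))) has_integral of_real (b k)) {0..pi}"
      unfolding o_def .
  qed
  show ?thesis
  proof (cases "even n")
    case False
    have "sphere_integral (\<lambda>y. cdot u (cvec y) ^ n) = (\<Sum>k\<le>n div 2. c k * of_real 0)"
    proof (rule outer)
      fix k assume "k \<le> n div 2"
      hence "odd (n - 2 * k)" using False by presburger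
      thus "((\<lambda>\<theta>. sin \<theta> ^ (2 * k + 1) * cos \<theta> ^ (n - 2 * k)) has_integral 0) {0..pi}"
        by (rule has_integral_sin_odd_cos_odd)
    qed
    thus ?thesis using False by simp
  next
    case True
    then obtain N where N: "n = 2 * N" by (elim evenE)
    define b where "b k = (2 * 4 ^ k * fact (N - k + k) * fact k * fact (2 * (N - k)) /
        (fact (N - k) * fact (2 * (N - k) + 2 * k + 1)) :: real)" for k
    have "sphere_integral (\<lambda>y. cdot u (cvec y) ^ n) = (\<Sum>k\<le>n div 2. c k * of_real (b k))"
    proof (rule outer)
      fix k assume "k \<le> n div 2"
      hence "n - 2 * k = 2 * (N - k)" using N by simp
      thus "((\<lambda>\<theta>. sin \<theta> ^ (2 * k + 1) * cos \<theta> ^ (n - 2 * k)) has_integral b k) {0..pi}"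
        unfolding b_def using has_integral_sin_odd_cos_even[of k "N - k"] by (simp only:)
    qed
    also have "\<dots> = (\<Sum>k\<le>N. of_real (4 * pi / real (n + 1)) * (of_nat (N choose k) * Q ^ k
        * ((u $ 3)\<^sup>2) ^ (N - k)))"
    proof (rule sum.cong)
      show "{..n div 2} = {..N}" using N by simp
      fix k assume "k \<in> {..N}"
      hence k: "k \<le> N" by simp
      have e: "n - 2 * k = 2 * (N - k)" using N by simp
      have "c k * of_real (b k) = of_real (2 * pi) * (Q / 4) ^ k * (u $ 3) ^ (n - 2 * k) *
         of_real (real (2 * N choose (2 * k)) * real (2 * k choose k) * b k)"
        by (simp add: c_def N mult_ac)
      also have "real (2 * N choose (2 * k)) * real (2 * k choose k) * b k
          = 4 ^ k * 2 / real (2 * N + 1) * real (N choose k)"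
        unfolding b_def by (rule beta_binomial_identity[OF k])
      finally show "c k * of_real (b k)
          = of_real (4 * pi / real (n + 1)) * (of_nat (N choose k) * Q ^ k * ((u $ 3)\<^sup>2) ^ (N - k))"
        unfolding e power_mult by (simp add: N power_divide divide_simps)
    qed
    also have "\<dots> = of_real (4 * pi / real (n + 1)) * (Q + (u $ 3)\<^sup>2) ^ N"
      unfolding binomial_ring sum_distrib_left ..
    also have "Q + (u $ 3)\<^sup>2 = cdot u u"
      by (simp add: Q_def cdot_def sum_3 power2_eq_square)
    finally show ?thesis using N by simp
  qed
qed

text \<open>
  The constant of the polarised moment formula: the coefficient of \<open>\<epsilon>\<^sup>l\<close> in
  \<open>4\<pi>/(n+l+1) \<cdot> (1 + 2\<epsilon>)\<^bsup>(n+l)/2\<^esup>\<close>, divided by the multiplicity \<open>n + l choose l\<close>.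
\<close>

definition null_moment :: "nat \<Rightarrow> nat \<Rightarrow> real" where
  "null_moment n l = (if even (n + l) \<and> l \<le> n
     then 4 * pi / real (n + l + 1) * real ((n + l) div 2 choose l) * 2 ^ l / real (n
         + l choose l) else 0)"

text \<open>
  Polarisation: for null \<open>v\<close>, \<open>(u + \<epsilon>v)\<cdot>(u + \<epsilon>v) = u\<cdot>u + 2\<epsilon> u\<cdot>v\<close>. Both sides of the moment formula
  for \<open>u + \<epsilon>v\<close> are polynomials in \<open>\<epsilon>\<close>, and the coefficients of \<open>\<epsilon>\<^sup>l\<close> agree.
\<close>

lemma sphere_moment_null:
  assumes "cdot v v = 0"
  shows "sphere_integral (\<lambda>y. cdot u (cvec y) ^ n * cdot v (cvec y) ^ l)
       = of_real (null_moment n l) * cdot u u ^ ((n - l) div 2) * cdot u v ^ l"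
proof -
  define M where "M = n + l"
  define J where "J i = sphere_integral (\<lambda>y. cdot v (cvec y) ^ i * cdot u (cvec y) ^ (M - i))" for i
  define g where "g i = (if even M then of_real (4 * pi / real (M + 1))
      * of_nat (M div 2 choose i) *
      (2 * cdot u v) ^ i * cdot u u ^ (M div 2 - i) else 0)" for i
  have "(\<Sum>i\<le>M. of_nat (M choose i) * J i * t ^ i) = (\<Sum>i\<le>M. g i * t ^ i)" for t
  proof -
    have "sphere_integral (\<lambda>y. cdot (u + t *s v) (cvec y) ^ M)
       = sphere_integral (\<lambda>y. \<Sum>i\<le>M. (of_nat (M choose i) * t ^ i) * (cdot v (cvec y) ^ i
           * cdot u (cvec y) ^ (M - i)))"
    proof (rule sphere_integral_cong)
      fix y
      have "cdot (u + t *s v) (cvec y) ^ M = (t * cdot v (cvec y) + cdot u (cvec y)) ^ M"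
        by (simp add: cdot_add_smult_left add.commute)
      thus "cdot (u + t *s v) (cvec y) ^ M =
         (\<Sum>i\<le>M. (of_nat (M choose i) * t ^ i) * (cdot v (cvec y) ^ i * cdot u (cvec y) ^ (M - i)))"
        by (simp add: binomial_ring power_mult_distrib mult_ac)
    qed
    also have "\<dots> = (\<Sum>i\<le>M. of_nat (M choose i) * J i * t ^ i)"
      unfolding J_def
      by (subst sphere_integral_sum, (intro continuous_intros)[1], intro sum.cong refl,
          subst sphere_integral_mult_left, (intro continuous_intros)[1]) (simp add: mult_ac)
    finally have "(\<Sum>i\<le>M. of_nat (M choose i) * J i * t ^ i)
       = (if even M then of_real (4 * pi / real (M + 1)) * cdot (u + t *s v) (u
           + t *s v) ^ (M div 2) else 0)"
      unfolding sphere_moment by simp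
    also have "cdot (u + t *s v) (u + t *s v) = 2 * cdot u v * t + cdot u u"
      unfolding cdot_add_smult_left cdot_add_smult_right using assms cdot_commute[of v u]
      by (simp add: algebra_simps)
    also have "(2 * cdot u v * t + cdot u u) ^ (M div 2)
       = (\<Sum>i\<le>M div 2. of_nat (M div 2 choose i) * (2 * cdot u v * t) ^ i
           * cdot u u ^ (M div 2 - i))"
      by (rule binomial_ring)
    \<comment> \<open>the binomial coefficients vanish for \<open>i > M div 2\<close>, so both polynomials can be given length
        \<open>M\<close>\<close>
    also have "\<dots> = (\<Sum>i\<le>M. of_nat (M div 2 choose i) * (2 * cdot u v * t) ^ i
        * cdot u u ^ (M div 2 - i))"
      by (rule sum.mono_neutral_left) auto
    also have "(if even M then of_real (4 * pi / real (M + 1)) * \<dots> else 0) = (\<Sum>i\<le>M. g i * t ^ i)"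
      by (simp add: g_def sum_distrib_left power_mult_distrib mult_ac)
    finally show ?thesis .
  qed
  hence "of_nat (M choose i) * J i = g i" if "i \<le> M" for i
    using polyfun_eq_coeffs[where n = M and c = "\<lambda>i. of_nat (M choose i) * J i" and d
        = g] that by blast
  from this[of l] have eq: "of_nat (M choose l) * J l = g l" by (simp add: M_def)
  have nz: "real (M choose l) \<noteq> 0" by (simp add: M_def)
  have "J l = g l / of_nat (M choose l)" using eq nz by (simp add: field_simps)
  also have "\<dots> = of_real (null_moment n l) * cdot u u ^ ((n - l) div 2) * cdot u v ^ l"
  proof (cases "even M \<and> l \<le> n")
    case True
    have "M div 2 - l = (n - l) div 2" using True by (auto simp: M_def)
    thus ?thesis using True nz
      by (simp add: g_def null_moment_def M_def[symmetric] power_mult_distrib mult_ac)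
  next
    case False
    hence "g l = 0" by (auto simp: g_def M_def binomial_eq_0)
    thus ?thesis using False by (auto simp: null_moment_def M_def)
  qed
  also have "J l = sphere_integral (\<lambda>y. cdot u (cvec y) ^ n * cdot v (cvec y) ^ l)"
    by (simp add: J_def M_def mult.commute)
  finally show ?thesis .
qed

text \<open>
  For a unit vector \<open>x\<close> the constant does not depend on \<open>x\<close>, so this is the Funk--Hecke formula
  for the kernel \<open>s\<^sup>n\<close> and a power of a null linear form.
\<close>

lemma sphere_moment_zonal:
  assumes "cdot v v = 0" "x \<in> sphere 0 1"
  shows "sphere_integral (\<lambda>y. of_real ((x \<bullet> y) ^ n) * cdot v (cvec y) ^ l)
       = of_real (null_moment n l) * cdot v (cvec x) ^ l"
proof -
  have "cdot (cvec x) (cvec x) = 1"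
    using assms(2) by (simp add: cdot_cvec dot_square_norm)
  thus ?thesis using sphere_moment_null[OF assms(1), of "cvec x" n l]
    by (simp add: cdot_cvec cdot_commute[of "cvec x" v])
qed

text \<open>
  If both vectors are null, a positive power of \<open>u\<cdot>u\<close> makes the moment vanish unless the degrees
  agree: harmonics of different degrees are orthogonal.
\<close>

lemma sphere_moment_null_null:
  assumes "cdot u u = 0" "cdot v v = 0"
  shows "sphere_integral (\<lambda>y. cdot u (cvec y) ^ n * cdot v (cvec y) ^ l)
       = (if n = l then of_real (4 * pi / real (2 * l + 1) * 2 ^ l / real (2 * l choose l))
           * cdot u v ^ l else 0)"
proof -
  consider "n = l" | "n > l" "even (n + l)" | "null_moment n l = 0" "n \<noteq> l"
    by (fastforce simp: null_moment_def)
  thus ?thesis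
  proof cases
    case 1
    have "null_moment l l = 4 * pi / real (2 * l + 1) * 2 ^ l / real (2 * l choose l)"
      unfolding null_moment_def mult_2[of l, symmetric] by simp
    thus ?thesis unfolding sphere_moment_null[OF assms(2)] using \<open>n = l\<close> by simp
  next
    case 2
    hence "(n - l) div 2 \<noteq> 0" by presburger
    hence "cdot u u ^ ((n - l) div 2) = 0" using assms(1) by (simp only: power_0_left if_False)
    thus ?thesis unfolding sphere_moment_null[OF assms(2)] using \<open>l < n\<close> by simp
  next
    case 3
    thus ?thesis unfolding sphere_moment_null[OF assms(2)] by simp
  qed
qed

section \<open>Spherical harmonics and powers of null linear forms\<close>

lemma poly_Taylor_sum:
  fixes p :: "'a :: field_char_0 poly"
  assumes "degree p \<le> n"
  shows "poly p (z + h) = (\<Sum>j\<le>n. poly ((pderiv ^^ j) p) z / fact j * h ^ j)"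
  using assms
proof (induction p arbitrary: n)
  case 0
  thus ?case by simp
next
  case (pCons a q)
  define T where "T j = poly ((pderiv ^^ j) q) z / fact j * h ^ j" for j
  have split: "pCons a q = [:a:] + [:0, 1:] * q" by simp
  have const: "(pderiv ^^ Suc i) [:a:] = 0" for i
    unfolding funpow_Suc_right by (simp add: pderiv_pCons)
  have der: "poly ((pderiv ^^ Suc i) (pCons a q)) z / fact (Suc i) * h ^ Suc i
      = z * T (Suc i) + h * T i" for i
  proof -
    have "poly ((pderiv ^^ Suc i) (pCons a q)) z
      = z * poly ((pderiv ^^ Suc i) q) z + of_nat (Suc i) * poly ((pderiv ^^ i) q) z"
      unfolding split higher_pderiv_add const higher_pderiv_X_mult
      by (simp del: funpow.simps of_nat_Suc)
    moreover have "of_nat (Suc i) / (fact (Suc i) :: 'a) = 1 / fact i"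
      by (simp del: of_nat_Suc)
    ultimately show ?thesis unfolding T_def
      by (simp add: add_divide_distrib distrib_right del: funpow.simps of_nat_Suc fact_Suc)
         (simp add: mult_ac del: of_nat_Suc funpow.simps)
  qed
  show ?case
  proof (cases "q = 0")
    case True
    have "poly ((pderiv ^^ j) [:a:]) z / fact j * h ^ j = (if j = 0 then a else 0)" for j
      using const by (cases j) (simp_all del: funpow.simps(2))
    thus ?thesis using True by (simp add: sum.delta)
  next
    case False
    hence "degree q + 1 \<le> n" using pCons.prems by simp
    then obtain m where m: "n = Suc m" "degree q \<le> m" by (cases n) auto
    have T1: "poly q (z + h) = (\<Sum>j\<le>m. T j)" and T2: "poly q (z + h) = (\<Sum>j\<le>Suc m. T j)"
      using pCons.IH[of m] pCons.IH[of "Suc m"] m by (auto simp: T_def)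
    have "(\<Sum>j\<le>n. poly ((pderiv ^^ j) (pCons a q)) z / fact j * h ^ j)
        = (a + z * poly q z) + (\<Sum>i\<le>m. z * T (Suc i) + h * T i)"
      unfolding m sum.atMost_Suc_shift der by simp
    also have "\<dots> = a + z * (T 0 + (\<Sum>i\<le>m. T (Suc i))) + h * (\<Sum>i\<le>m. T i)"
      by (simp add: sum.distrib sum_distrib_left T_def algebra_simps)
    also have "T 0 + (\<Sum>i\<le>m. T (Suc i)) = poly q (z + h)"
      unfolding T2 by (rule sum.atMost_Suc_shift[symmetric])
    also have "(\<Sum>i\<le>m. T i) = poly q (z + h)" unfolding T1 ..
    finally show ?thesis by (simp add: algebra_simps)
  qed
qed

lemma map_poly_of_real_mult:
  "map_poly (of_real :: real \<Rightarrow> complex) (p * q) = map_poly of_real p * map_poly of_real q"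
  by (rule poly_eqI) (simp add: coeff_map_poly coeff_mult)

lemma poly_map_poly_of_real:
  "poly (map_poly (of_real :: real \<Rightarrow> complex) p) (of_real x) = of_real (poly p x)"
  by (induction p) (simp_all add: map_poly_pCons)

lemma higher_pderiv_map_poly_of_real:
  "(pderiv ^^ j) (map_poly (of_real :: real \<Rightarrow> complex) p) = map_poly of_real ((pderiv ^^ j) p)"
proof (induction j)
  case (Suc j)
  have "pderiv (map_poly (of_real :: real \<Rightarrow> complex) q) = map_poly of_real (pderiv q)" for q
    by (rule poly_eqI) (simp add: coeff_map_poly coeff_pderiv)
  thus ?case using Suc by simp
qed simp

text \<open>
  Taylor's formula at a real point with a complex increment; its coefficients are the derivatives
  that occur in Rodrigues' formula.
\<close>

lemma one_minus_square_power_Taylor: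
  fixes t :: real and h :: complex
  shows "(1 - (of_real t + h)\<^sup>2) ^ l
    = (\<Sum>j\<le>2 * l. of_real (poly ((pderiv ^^ j) ([:1, 0, -1:] ^ l)) t) / fact j * h ^ j)"
proof -
  let ?w = "[:1, 0, -1:] :: complex poly"
  have w: "map_poly of_real ([:1, 0, -1:] ^ l) = ?w ^ l"
  proof (induction l)
    case (Suc l)
    have "map_poly of_real [:1, 0, -1:] = ?w" by (simp add: map_poly_pCons)
    thus ?case using Suc by (simp only: power_Suc map_poly_of_real_mult)
  qed (simp add: map_poly_pCons)
  have "degree (?w ^ l) \<le> 2 * l"
    by (rule order_trans[OF degree_power_le]) simp
  from poly_Taylor_sum[OF this, of "of_real t" h]
  have *: "poly (?w ^ l) (of_real t + h)
    = (\<Sum>j\<le>2 * l. of_real (poly ((pderiv ^^ j) ([:1, 0, -1:] ^ l)) t) / fact j * h ^ j)"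
    unfolding w[symmetric] higher_pderiv_map_poly_of_real poly_map_poly_of_real .
  show ?thesis
  proof -
    have "poly ?w z = 1 - z\<^sup>2" for z by (simp add: power2_eq_square)
    thus ?thesis using * by (simp only: poly_power)
  qed
qed

lemma assoc_legendre_0: "assoc_legendre l 0 t = poly (legendre l) t"
  by (simp add: assoc_legendre_def legendre_def)

lemma legendre_at_minus_1: "poly (legendre n) (-1) = (-1) ^ n"
proof -
  have "poly (legendre n) (-1) = (-1) ^ n \<and> poly (legendre (Suc n)) (-1) = (-1) ^ Suc n" for n
  proof (induction n)
    case (Suc n)
    have "real (n + 2) * poly (legendre (n+2)) (-1) = real (n + 2) * (-1) ^ n"
      unfolding legendre_recurrence using Suc by (simp add: algebra_simps)
    hence "poly (legendre (n+2)) (-1) = (-1) ^ n" by (simp del: of_nat_add)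
    thus ?case using Suc by simp
  qed (simp add: legendre_1)
  thus ?thesis by blast
qed

text \<open>
  Laplace's formula. In Taylor's formula for \<open>(1 - x\<^sup>2)\<^sup>l\<close> at \<open>t\<close> take the increment \<open>h = r w\<close>
  with \<open>r = sqrt(1 - t\<^sup>2)\<close> and \<open>w = e\<^bsup>i\<beta>\<^esup>\<close>. Since \<open>1 - t\<^sup>2 = r\<^sup>2\<close>, the left-hand side factors as
  \<open>(-2rw)\<^sup>l (t + i r sin \<beta>)\<^sup>l\<close>, and the \<open>j\<close>-th Taylor term divided by \<open>(-2rw)\<^sup>l\<close> is a multiple of
  \<open>P\<^sub>l\<^bsup>j-l\<^esup>(t) e\<^bsup>i(j-l)\<beta>\<^esup>\<close>. At \<open>t = 1\<close> and \<open>t = -1\<close>, where \<open>r = 0\<close>, only the term \<open>j = l\<close> remains.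
\<close>

lemma Laplace_assoc_legendre:
  assumes "-1 \<le> t" "t \<le> 1"
  shows "(of_real t + \<i> * of_real (sqrt (1 - t\<^sup>2) * sin \<beta>)) ^ l
    = (\<Sum>j\<le>2 * l. of_real ((-1) ^ (j + l) * fact l / fact j * assoc_legendre l (int j - int l) t)
          * cis (of_int (int j - int l) * \<beta>))" (is "_ = ?R")
proof -
  define r where "r = sqrt (1 - t\<^sup>2)"
  have t2: "t\<^sup>2 \<le> 1" using assms by (simp add: abs_square_le_1)
  have r2: "r\<^sup>2 = 1 - t\<^sup>2" using t2 by (simp add: r_def)
  define D where "D j = poly ((pderiv ^^ j) ([:1, 0, -1:] ^ l)) t" for j
  show ?thesis
  proof (cases "r = 0")
    case True
    hence "t\<^sup>2 = 1" using r2 by simp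
    hence t: "t = 1 \<or> t = -1" by (simp add: power2_eq_1_iff)
    have "?R = (\<Sum>j\<le>2 * l. if j = l then of_real (poly (legendre l) t) else 0)"
    proof (intro sum.cong refl)
      fix j
      show "of_real ((-1) ^ (j + l) * fact l / fact j * assoc_legendre l (int j - int l) t)
          * cis (of_int (int j - int l) * \<beta>)
        = (if j = l then of_real (poly (legendre l) t) else 0)"
        using True unfolding r_def
        by (cases "j = l") (simp_all add: legendre_def assoc_legendre_def flip: power_mult_distrib)
    qed
    also have "\<dots> = of_real (poly (legendre l) t)" by (simp add: sum.delta)
    also have "\<dots> = of_real t ^ l" using t by (auto simp: legendre_at_minus_1)
    finally show ?thesis using True by (simp add: r_def)
  next
    case False
    define w where "w = cis \<beta>"
    have w0: "w \<noteq> 0" by (simp add: w_def)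
    have ww: "w\<^sup>2 - 1 = 2 * \<i> * of_real (sin \<beta>) * w"
      by (simp add: w_def complex_eq_iff power2_eq_square) (use sin_cos_squared_add3[of \<beta>] in
          algebra)
    have "1 - (of_real t + of_real r * w)\<^sup>2
        = of_real (r\<^sup>2) - 2 * of_real (t * r) * w - of_real (r\<^sup>2) * w\<^sup>2"
    proof -
      have "(1 :: complex) = of_real (r\<^sup>2) + of_real (t\<^sup>2)" unfolding r2 by simp
      thus ?thesis by (subst (1) \<open>1 = _\<close>) (simp add: power2_eq_square algebra_simps)
    qed
    also have "\<dots> = - (2 * of_real (t * r) * w) - of_real (r\<^sup>2) * (w\<^sup>2 - 1)"
      by (simp add: algebra_simps)
    also have "\<dots> = (- 2 * of_real r * w) * (of_real t + \<i> * of_real (r * sin \<beta>))"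
      unfolding ww by (simp add: power2_eq_square algebra_simps)
    finally have key: "(- 2 * of_real r * w) ^ l * (of_real t + \<i> * of_real (r * sin \<beta>)) ^ l
       = (\<Sum>j\<le>2 * l. of_real (D j) / fact j * (of_real r * w) ^ j)"
      unfolding D_def one_minus_square_power_Taylor[symmetric] power_mult_distrib[symmetric] by simp
    have nz: "(- 2 * of_real r * w) ^ l \<noteq> 0" using False w0 by simp
    have "(of_real t + \<i> * of_real (r * sin \<beta>)) ^ l
       = (\<Sum>j\<le>2 * l. of_real (D j) / fact j * (of_real r * w) ^ j / (- 2 * of_real r * w) ^ l)"
      unfolding sum_divide_distrib[symmetric] key[symmetric] using nz by simp
    also have "\<dots> = ?R"
    proof (intro sum.cong refl)
      fix j assume "j \<in> {..2 * l}"
      have e1: "of_real r ^ j / of_real r ^ l = complex_of_real (r powi (int j - int l))"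
        using False by (simp add: power_int_diff)
      have e2: "w ^ j / w ^ l = cis (of_int (int j - int l) * \<beta>)"
        using w0 unfolding w_def
        by (simp add: Complex.DeMoivre cis_divide left_diff_distrib)
      have e3: "nat (int l + (int j - int l)) = j" by simp
      have sg: "((-1) ^ (j + l) * (-1) ^ j :: real) = 1 / (-1) ^ l"
        by (cases "even j"; cases "even l") simp_all
      have "of_real (D j) / fact j * (of_real r * w) ^ j / (- 2 * of_real r * w) ^ l
         = of_real (D j) / fact j / (-2) ^ l * (of_real r ^ j / of_real r ^ l) * (w ^ j / w ^ l)"
        by (simp only: power_mult_distrib times_divide_eq_left times_divide_eq_right
            divide_divide_eq_left mult_ac)
      also have "\<dots> = of_real (D j / fact j / (-2) ^ l * (r powi (int j - int l)))
          * cis (of_int (int j - int l) * \<beta>)"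
        unfolding e1 e2 by simp
      also have "D j / fact j / (-2) ^ l * (r powi (int j - int l))
        = (-1) ^ (j + l) * fact l / fact j * assoc_legendre l (int j - int l) t"
      proof -
        have "(-1) ^ (j + l) * fact l / fact j * assoc_legendre l (int j - int l) t
          = ((-1) ^ (j + l) * (-1) ^ j) * (fact l / fact j / (2 ^ l * fact l)
              * (r powi (int j - int l)) * D j)"
          unfolding assoc_legendre_def e3 r_def[symmetric] D_def[symmetric] by simp
        also have "\<dots> = D j / fact j / ((-1) ^ l * 2 ^ l) * (r powi (int j - int l))"
          unfolding sg by (simp add: divide_simps)
        finally show ?thesis by (simp flip: power_mult_distrib)
      qed
      finally show "of_real (D j) / fact j * (of_real r * w) ^ j / (- 2 * of_real r * w) ^ l
        = of_real ((-1) ^ (j + l) * fact l / fact j * assoc_legendre l (int j - int l) t)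
            * cis (of_int (int j - int l) * \<beta>)" .
    qed
    finally show ?thesis by (simp add: r_def)
  qed
qed

lemma sum_int_symmetric:
  fixes f :: "int \<Rightarrow> 'a :: comm_monoid_add"
  shows "(\<Sum>m = - int l..int l. f m) = (\<Sum>j\<le>2 * l. f (int j - int l))"
  by (rule sum.reindex_bij_witness[of _ "\<lambda>j. int j - int l" "\<lambda>m. nat (m + int l)"]) auto

text \<open>
  The circle of null vectors for which \<open>v\<^sub>\<alpha>\<cdot>y = cos \<vartheta> + i sin \<vartheta> sin(\<alpha> + \<phi>)\<close> at the point \<open>y\<close> with
  spherical coordinates \<open>(\<vartheta>, \<phi>)\<close>, as needed for Laplace's formula.
\<close>

definition null_vec :: "real \<Rightarrow> complex ^ 3" where
  "null_vec \<alpha> = vector [\<i> * of_real (sin \<alpha>), \<i> * of_real (cos \<alpha>), 1]"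

lemma cdot_null_vec [simp]: "cdot (null_vec \<alpha>) (null_vec \<alpha>) = 0"
proof -
  have "complex_of_real (sin \<alpha>) * of_real (sin \<alpha>) + of_real (cos \<alpha>) * of_real (cos \<alpha>) = 1"
    by (simp only: of_real_mult[symmetric] of_real_add[symmetric] add.commute[of "sin \<alpha>
        * sin \<alpha>"] sin_cos_squared_add3) simp
  thus ?thesis
    by (simp add: cdot_def null_vec_def sum_3 algebra_simps)
qed

text \<open>
  The coefficient of \<open>Y\<^sub>l\<^sup>m\<close> in the expansion of \<open>(v\<^sub>\<alpha>\<cdot>y)\<^sup>l\<close>. The exponent of the sign is \<open>m\<close>,
  shifted by an even number so that it is a natural number.
\<close>

definition harm_coeff :: "nat \<Rightarrow> int \<Rightarrow> real" where
  "harm_coeff l m = (-1) ^ nat (m + 2 * int l) * fact l * sqrt (4 * pi / (2 * real l + 1)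
      / (fact (nat (int l + m)) * fact (nat (int l - m))))"

lemma harm_coeff_nonzero: "harm_coeff l m \<noteq> 0"
  by (simp add: harm_coeff_def)

text \<open>
  The squares are proportional to binomial coefficients, which is what the orthonormality amounts
  to: they are the Fourier coefficients of \<open>(1 + cos \<delta>)\<^sup>l\<close>.
\<close>

lemma harm_coeff_square:
  assumes "\<bar>m\<bar> \<le> int l"
  shows "(harm_coeff l m)\<^sup>2 = 4 * pi / (2 * real l + 1) / real (2 * l choose l) * real (2
      * l choose nat (int l + m))"
proof -
  have 1: "real (2 * l choose l) = fact (2 * l) / (fact l * fact l)"
    by (subst binomial_fact) auto
  have "2 * l - nat (int l + m) = nat (int l - m)" using assms by auto
  hence 2: "real (2 * l choose nat (int l + m))
      = fact (2 * l) / (fact (nat (int l + m)) * fact (nat (int l - m)))"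
    using assms by (subst binomial_fact) auto
  show ?thesis unfolding 1 2 harm_coeff_def power_mult_distrib
    by (simp add: power2_eq_square flip: power_mult_distrib) 
qed

text \<open>
  Laplace's formula with the azimuth \<open>\<phi>\<close> of \<open>y\<close> shifted by \<open>\<alpha>\<close>: its Fourier expansion in \<open>\<alpha> + \<phi>\<close>
  collects the factors \<open>e\<^bsup>im\<phi>\<^esup>\<close> that complete \<open>P\<^sub>l\<^sup>m(cos \<vartheta>)\<close> to spherical harmonics.
\<close>

lemma null_vec_expansion:
  assumes "y \<in> sphere 0 1"
  shows "cdot (null_vec \<alpha>) (cvec y) ^ l
    = (\<Sum>m = -int l..int l. of_real (harm_coeff l m) * sph_harm l m y * cis (of_int m * \<alpha>))"
proof -
  obtain \<theta> \<phi> where th: "0 \<le> \<theta>" "\<theta> \<le> pi" and y: "y = sph_point \<theta> \<phi>"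
    using sph_point_surj[OF assms] .
  have s: "sqrt (1 - (cos \<theta>)\<^sup>2) = sin \<theta>"
    using sin_ge_zero[OF th] by (simp add: sin_squared_eq[symmetric])
  have "cdot (null_vec \<alpha>) (cvec y) = of_real (cos \<theta>) + \<i> * of_real (sqrt (1 - (cos \<theta>)\<^sup>2) * sin (\<alpha>
      + \<phi>))"
    unfolding s by (simp add: y cdot_def null_vec_def cvec_def sph_point_def sum_3 sin_add
        algebra_simps)
  hence "cdot (null_vec \<alpha>) (cvec y) ^ l
    = (\<Sum>j\<le>2 * l. of_real ((-1) ^ (j + l) * fact l / fact j
        * assoc_legendre l (int j - int l) (cos \<theta>))
          * cis (of_int (int j - int l) * (\<alpha> + \<phi>)))"
    by (simp only: Laplace_assoc_legendre cos_le_one cos_ge_minus_one)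
  also have "\<dots> = (\<Sum>j\<le>2 * l. of_real (harm_coeff l (int j - int l)) * sph_harm l (int j - int l) y
      * cis (of_int (int j - int l) * \<alpha>))"
  proof (intro sum.cong refl)
    fix j assume "j \<in> {..2 * l}"
    hence j: "j \<le> 2 * l" by simp
    define m where "m = int j - int l"
    have n: "nat (m + 2 * int l) = j + l" "nat (int l + m) = j" "nat (int l - m) = 2 * l - j"
      using j by (auto simp: m_def)
    have c: "harm_coeff l m * sqrt ((2 * real l + 1) / (4 * pi)
        * (fact (nat (int l - m)) / fact (nat (int l + m))))
       = (-1) ^ (j + l) * fact l / fact j"
    proof -
      have "sqrt (4 * pi / (2 * real l + 1) / (fact j * fact (2 * l - j)))
          * sqrt ((2 * real l + 1) / (4 * pi) * (fact (2 * l - j) / fact j))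
          = sqrt ((1 / fact j)\<^sup>2)"
        unfolding real_sqrt_mult[symmetric]
        by (rule arg_cong[of _ _ sqrt]) (simp add: divide_simps power2_eq_square)
      also have "\<dots> = 1 / fact j" by simp
      finally show ?thesis unfolding harm_coeff_def n by (simp only: mult.assoc) simp
    qed
    have e: "exp (\<i> * of_int m * of_real \<phi>) * cis (of_int m * \<alpha>) = cis (of_int m * (\<alpha> + \<phi>))"
      by (simp add: cis_conv_exp algebra_simps exp_add)
    have "of_real (harm_coeff l m) * sph_harm l m y * cis (of_int m * \<alpha>)
       = of_real (harm_coeff l m * sqrt ((2 * real l + 1) / (4 * pi)
           * (fact (nat (int l - m)) / fact (nat (int l + m))))
            * assoc_legendre l m (cos \<theta>)) * (exp (\<i> * of_int m * of_real \<phi>) * cis (of_int m * \<alpha>))"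
      unfolding y sph_harm_sph_point[OF th] sph_harm_ang_def by simp
    also have "\<dots> = of_real ((-1) ^ (j + l) * fact l / fact j * assoc_legendre l m (cos \<theta>))
        * cis (of_int m * (\<alpha> + \<phi>))"
      unfolding c e ..
    finally show "of_real ((-1) ^ (j + l) * fact l / fact j
        * assoc_legendre l (int j - int l) (cos \<theta>))
          * cis (of_int (int j - int l) * (\<alpha> + \<phi>))
       = of_real (harm_coeff l (int j - int l)) * sph_harm l (int j - int l) y
           * cis (of_int (int j - int l) * \<alpha>)"
      by (simp add: m_def)
  qed
  finally show ?thesis unfolding sum_int_symmetric .
qed

section \<open>Orthonormality and the Funk--Hecke formula\<close>

text \<open>
  As \<open>(v\<^sub>\<alpha>\<cdot>y)\<^sup>l\<close> is a trigonometric polynomial of degree \<open>l\<close> in \<open>\<alpha>\<close>, its coefficients are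
  recovered from \<open>2l + 1\<close> equispaced values. A finite sum, unlike an integral over \<open>\<alpha>\<close>, commutes
  with the integral over the sphere by linearity alone.
\<close>

definition fourier_node :: "nat \<Rightarrow> nat \<Rightarrow> real" where
  "fourier_node l j = 2 * pi * real j / real (2 * l + 1)"

definition fourier_weight :: "nat \<Rightarrow> int \<Rightarrow> nat \<Rightarrow> complex" where
  "fourier_weight l m j = cis (- (of_int m * fourier_node l j)) / of_real (real (2 * l + 1)
      * harm_coeff l m)"

lemma sum_cis_fourier_node:
  assumes "\<bar>k\<bar> \<le> 2 * int l"
  shows "(\<Sum>j<2 * l + 1. cis (of_int k * fourier_node l j)) = (if k
      = 0 then of_nat (2 * l + 1) else 0)"
proof (cases "k = 0")
  case False
  define z where "z = cis (of_int k * (2 * pi / real (2 * l + 1)))"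
  have pow: "cis (of_int k * fourier_node l j) = z ^ j" for j
    by (simp add: z_def fourier_node_def Complex.DeMoivre mult_ac)
  have "z \<noteq> 1"
  proof
    assume "z = 1"
    then obtain n :: int where "of_int k * (2 * pi / real (2 * l + 1)) = of_int (2 * n) * pi"
      unfolding z_def cis_conv_exp exp_eq_1 by auto
    hence "real_of_int k = of_int (n * int (2 * l + 1))"
      by (simp add: field_simps del: of_nat_add of_nat_Suc)
    hence k: "k = n * int (2 * l + 1)" by linarith
    hence "n \<noteq> 0" using False by auto
    hence "1 * int (2 * l + 1) \<le> \<bar>n\<bar> * int (2 * l + 1)" by (intro mult_right_mono) auto
    also have "\<dots> = \<bar>k\<bar>" unfolding k by (simp add: abs_mult)
    finally show False using assms by simp
  qed
  moreover have "z ^ (2 * l + 1) = 1"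
  proof -
    have "real (2 * l + 1) * (of_int k * (2 * pi / real (2 * l + 1))) = 2 * pi * of_int k"
      by (simp add: field_simps del: of_nat_add of_nat_Suc)
    thus ?thesis unfolding z_def Complex.DeMoivre by (simp only: cis_multiple_2pi Ints_of_int)
  qed
  ultimately show ?thesis unfolding pow using False geometric_sum[of z "2 * l + 1"] by simp
qed simp

text \<open>
  The weights extract the coefficient of index \<open>m\<close> and normalise it by \<open>harm_coeff\<close>.
\<close>

lemma fourier_weight_dual:
  assumes "\<bar>m\<bar> \<le> int l" "\<bar>\<mu>\<bar> \<le> int l"
  shows "(\<Sum>j<2 * l + 1. fourier_weight l m j * cis (of_int \<mu> * fourier_node l j))
       = (if \<mu> = m then 1 / of_real (harm_coeff l m) else 0)"
proof -
  have "fourier_weight l m j * cis (of_int \<mu> * fourier_node l j)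
      = cis (of_int (\<mu> - m) * fourier_node l j) / of_real (real (2 * l + 1) * harm_coeff l m)" for j
    by (simp add: fourier_weight_def cis_mult algebra_simps)
  hence "(\<Sum>j<2 * l + 1. fourier_weight l m j * cis (of_int \<mu> * fourier_node l j))
      = (\<Sum>j<2 * l + 1. cis (of_int (\<mu> - m) * fourier_node l j)) / of_real (real (2 * l + 1)
          * harm_coeff l m)"
    by (simp only: sum_divide_distrib)
  also have "\<dots> = (if \<mu> - m = 0 then of_nat (2 * l + 1) else 0) / of_real (real (2 * l + 1)
      * harm_coeff l m)"
    by (subst sum_cis_fourier_node) (use assms in auto)
  finally show ?thesis by (simp del: of_nat_add of_nat_Suc of_nat_mult)
qed

lemma sph_harm_null_powers:
  assumes "\<bar>m\<bar> \<le> int l" "y \<in> sphere 0 1"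
  shows "sph_harm l m y = (\<Sum>j<2 * l + 1. fourier_weight l m j
      * cdot (null_vec (fourier_node l j)) (cvec y) ^ l)"
proof -
  have "(\<Sum>j<2 * l + 1. fourier_weight l m j * cdot (null_vec (fourier_node l j)) (cvec y) ^ l)
    = (\<Sum>j<2 * l + 1. \<Sum>\<mu> = -int l..int l. of_real (harm_coeff l \<mu>) * sph_harm l \<mu> y *
         (fourier_weight l m j * cis (of_int \<mu> * fourier_node l j)))"
    unfolding null_vec_expansion[OF assms(2)] sum_distrib_left by (simp only: mult_ac)
  also have "\<dots> = (\<Sum>\<mu> = -int l..int l. of_real (harm_coeff l \<mu>) * sph_harm l \<mu> y *
         (\<Sum>j<2 * l + 1. fourier_weight l m j * cis (of_int \<mu> * fourier_node l j)))"
    unfolding sum_distrib_left by (rule sum.swap)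
  also have "\<dots> = (\<Sum>\<mu> = -int l..int l. if \<mu> = m then sph_harm l m y else 0)"
    by (intro sum.cong refl) (use assms(1) in \<open>subst fourier_weight_dual, auto
        simp: harm_coeff_nonzero\<close>)
  also have "\<dots> = sph_harm l m y"
    using assms(1) by (subst sum.delta) auto
  finally show ?thesis ..
qed

lemma continuous_on_sph_harm:
  assumes "\<bar>m\<bar> \<le> int l"
  shows "continuous_on (sphere 0 1) (sph_harm l m)"
proof -
  have "continuous_on (sphere 0 1)
     (\<lambda>y. \<Sum>j<2 * l + 1. fourier_weight l m j * cdot (null_vec (fourier_node l j)) (cvec y) ^ l)"
    by (intro continuous_intros)
  thus ?thesis by (rule continuous_on_eq) (simp add: sph_harm_null_powers[OF assms])
qed

text \<open>
  \<open>2(1 + cos \<delta>)\<close> is the square of \<open>e\<^bsup>i\<delta>/2\<^esup> + e\<^bsup>-i\<delta>/2\<^esup>\<close>.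
\<close>

lemma one_plus_cos_power:
  "of_real ((1 + cos \<delta>) ^ l) = (\<Sum>\<mu> = -int l..int l. of_nat (2 * l choose nat (int l + \<mu>))
      * cis (of_int \<mu> * \<delta>)) / 2 ^ l"
proof -
  have c: "cis (\<delta> / 2) * cis (\<delta> / 2) = cis \<delta>" "cis (- \<delta> / 2) * cis (- \<delta> / 2) = cis (- \<delta>)"
    "cis (\<delta> / 2) * cis (- \<delta> / 2) = 1"
    by (simp_all add: cis_mult)
  have "(cis (\<delta> / 2) + cis (- \<delta> / 2))\<^sup>2 = of_real (2 * (1 + cos \<delta>))"
    unfolding power2_eq_square distrib_left distrib_right c
    by (simp add: mult.commute[of "cis (-\<delta>/2)"] c complex_eq_iff)
  hence "of_real (2 * (1 + cos \<delta>)) ^ l = (cis (\<delta> / 2) + cis (- \<delta> / 2)) ^ (2 * l)"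
    by (simp only: power_mult)
  also have "\<dots> = (\<Sum>j\<le>2 * l. of_nat (2 * l choose j) * cis (\<delta> / 2) ^ j * cis (- \<delta> / 2) ^ (2
      * l - j))"
    by (rule binomial_ring)
  also have "\<dots> = (\<Sum>j\<le>2 * l. of_nat (2 * l choose j) * cis (of_int (int j - int l) * \<delta>))"
  proof (intro sum.cong refl)
    fix j assume "j \<in> {..2 * l}"
    hence "real j * (\<delta> / 2) + real (2 * l - j) * (- \<delta> / 2) = of_int (int j - int l) * \<delta>"
      by (simp add: of_nat_diff field_simps)
    thus "of_nat (2 * l choose j) * cis (\<delta> / 2) ^ j * cis (- \<delta> / 2) ^ (2 * l - j) =
          of_nat (2 * l choose j) * cis (of_int (int j - int l) * \<delta>)"
      by (simp only: Complex.DeMoivre mult.assoc cis_mult)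
  qed
  also have "\<dots> = (\<Sum>\<mu> = -int l..int l. of_nat (2 * l choose nat (int l + \<mu>)) * cis (of_int \<mu> * \<delta>))"
    unfolding sum_int_symmetric by simp
  finally have S: "of_real (2 * (1 + cos \<delta>)) ^ l
      = (\<Sum>\<mu> = -int l..int l. of_nat (2 * l choose nat (int l + \<mu>)) * cis (of_int \<mu> * \<delta>))" .
  have "complex_of_real (2 * (1 + cos \<delta>)) ^ l = 2 ^ l * of_real ((1 + cos \<delta>) ^ l)"
    by (simp only: of_real_mult power_mult_distrib of_real_power of_real_numeral)
  thus ?thesis unfolding S by simp
qed

text \<open>
  Complex conjugation maps the null vector of angle \<open>\<beta>\<close> to that of angle \<open>\<beta> + \<pi>\<close>, and the product
  of the null vectors of angles \<open>\<alpha>\<close> and \<open>\<beta> + \<pi>\<close> is \<open>1 + cos(\<alpha> - \<beta>)\<close>.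
\<close>

lemma null_vec_moments:
  "sphere_integral (\<lambda>y. cdot (null_vec \<alpha>) (cvec y) ^ l * cnj (cdot (null_vec \<beta>) (cvec y) ^ l'))
     = (if l = l' then \<Sum>\<mu> = -int l..int l. of_real ((harm_coeff l \<mu>)\<^sup>2) * cis (of_int \<mu>
         * (\<alpha> - \<beta>)) else 0)"
proof -
  have "cnj (cdot (null_vec \<beta>) (cvec y)) = cdot (null_vec (\<beta> + pi)) (cvec y)" for y
    by (simp add: cdot_def null_vec_def cvec_def sum_3)
  hence "sphere_integral (\<lambda>y. cdot (null_vec \<alpha>) (cvec y) ^ l
      * cnj (cdot (null_vec \<beta>) (cvec y) ^ l'))
    = (if l = l' then of_real (4 * pi / real (2 * l' + 1) * 2 ^ l' / real (2 * l' choose l'))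
        * cdot (null_vec \<alpha>) (null_vec (\<beta> + pi)) ^ l' else 0)"
    by (simp add: sphere_moment_null_null)
  moreover have "cdot (null_vec \<alpha>) (null_vec (\<beta> + pi)) = of_real (1 + cos (\<alpha> - \<beta>))"
    by (simp add: cdot_def null_vec_def sum_3 cos_diff algebra_simps)
  moreover have "of_real (4 * pi / real (2 * l + 1) * 2 ^ l / real (2 * l choose l)) * of_real (1
      + cos (\<alpha> - \<beta>)) ^ l
     = (\<Sum>\<mu> = -int l..int l. of_real ((harm_coeff l \<mu>)\<^sup>2) * cis (of_int \<mu> * (\<alpha> - \<beta>)))"
  proof -
    have "(\<Sum>\<mu> = -int l..int l. of_real ((harm_coeff l \<mu>)\<^sup>2) * cis (of_int \<mu> * (\<alpha> - \<beta>)))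
       = (\<Sum>\<mu> = -int l..int l. of_real (4 * pi / real (2 * l + 1) / real (2 * l choose l)) *
            (of_nat (2 * l choose nat (int l + \<mu>)) * cis (of_int \<mu> * (\<alpha> - \<beta>))))"
      by (intro sum.cong refl) (subst harm_coeff_square, auto simp: add.commute)
    also have "\<dots> = of_real (4 * pi / real (2 * l + 1) / real (2 * l choose l)) *
        (2 ^ l * of_real ((1 + cos (\<alpha> - \<beta>)) ^ l))"
      unfolding sum_distrib_left[symmetric] one_plus_cos_power by simp
    finally show ?thesis by simp
  qed
  ultimately show ?thesis by auto
qed

text \<open>
  Both functions are combinations of powers of null linear forms. In \<open>null_vec_moments\<close> the two
  sums over the nodes separate, and the weights pick out \<open>\<mu> = m\<close> and \<open>\<mu> = m'\<close>, respectively.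
\<close>

lemma sph_harm_orthonormal:
  assumes "\<bar>m\<bar> \<le> int l" "\<bar>m'\<bar> \<le> int l'"
  shows "sphere_integral (\<lambda>y. sph_harm l m y * cnj (sph_harm l' m' y)) = (if l = l' \<and> m
      = m' then 1 else 0)"
proof -
  let ?p = "\<lambda>l j y. cdot (null_vec (fourier_node l j)) (cvec y) ^ l"
  have "sphere_integral (\<lambda>y. sph_harm l m y * cnj (sph_harm l' m' y))
    = sphere_integral (\<lambda>y. \<Sum>j<2 * l + 1. \<Sum>i<2 * l' + 1.
         (fourier_weight l m j * cnj (fourier_weight l' m' i)) * (?p l j y * cnj (?p l' i y)))"
    by (rule sphere_integral_cong)
       (simp only: sph_harm_null_powers[OF assms(1)] sph_harm_null_powers[OF assms(2)] cnj_sum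
           sum_product
          complex_cnj_mult mult_ac)
  also have "\<dots> = (\<Sum>j<2 * l + 1. \<Sum>i<2 * l' + 1. (fourier_weight l m j
      * cnj (fourier_weight l' m' i)) *
      sphere_integral (\<lambda>y. ?p l j y * cnj (?p l' i y)))"
    by (subst sphere_integral_sum, (intro continuous_intros)[1], intro sum.cong refl,
        subst sphere_integral_sum, (intro continuous_intros)[1], intro sum.cong refl,
        rule sphere_integral_mult_left, intro continuous_intros)
  also have "\<dots> = (if l = l' \<and> m = m' then 1 else 0)"
  proof (cases "l = l'")
    case False
    thus ?thesis unfolding null_vec_moments by simp
  next
    case True
    note \<open>l = l'\<close>[symmetric, simp]
    have m': "\<bar>m'\<bar> \<le> int l" using assms(2) by simp
    let ?f = "\<lambda>m \<mu>. \<Sum>j<2 * l + 1. fourier_weight l m j * cis (of_int \<mu> * fourier_node l j)"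
    have "(\<Sum>j<2 * l + 1. \<Sum>i<2 * l + 1. (fourier_weight l m j * cnj (fourier_weight l m' i)) *
         (\<Sum>\<mu> = -int l..int l. of_real ((harm_coeff l \<mu>)\<^sup>2) * cis (of_int \<mu>
             * (fourier_node l j - fourier_node l i))))
      = (\<Sum>j<2 * l + 1. \<Sum>i<2 * l + 1. \<Sum>\<mu> = -int l..int l. of_real ((harm_coeff l \<mu>)\<^sup>2) *
         ((fourier_weight l m j * cis (of_int \<mu> * fourier_node l j)) *
          cnj (fourier_weight l m' i * cis (of_int \<mu> * fourier_node l i))))"
      unfolding sum_distrib_left
    proof (intro sum.cong refl)
      fix j i \<mu>
      have "cis (of_int \<mu> * (fourier_node l j - fourier_node l i))
        = cis (of_int \<mu> * fourier_node l j) * cnj (cis (of_int \<mu> * fourier_node l i))"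
        by (simp add: cis_cnj cis_mult algebra_simps)
      thus "fourier_weight l m j * cnj (fourier_weight l m' i) *
           (of_real ((harm_coeff l \<mu>)\<^sup>2) * cis (of_int \<mu> * (fourier_node l j - fourier_node l i)))
         = of_real ((harm_coeff l \<mu>)\<^sup>2) * ((fourier_weight l m j * cis (of_int \<mu>
             * fourier_node l j)) *
          cnj (fourier_weight l m' i * cis (of_int \<mu> * fourier_node l i)))"
        by (simp only: complex_cnj_mult mult_ac)
    qed
    also have "\<dots> = (\<Sum>\<mu> = -int l..int l. \<Sum>j<2 * l + 1. \<Sum>i<2 * l + 1. of_real ((harm_coeff l \<mu>)\<^sup>2) *
         ((fourier_weight l m j * cis (of_int \<mu> * fourier_node l j)) *
          cnj (fourier_weight l m' i * cis (of_int \<mu> * fourier_node l i))))"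
      by (simp only: sum.swap[of _ "{- int l..int l}"])
    also have "\<dots> = (\<Sum>\<mu> = -int l..int l. of_real ((harm_coeff l \<mu>)\<^sup>2) * (?f m \<mu> * cnj (?f m' \<mu>)))"
    proof -
      have "?f m \<mu> * cnj (?f m' \<mu>) = (\<Sum>j<2 * l + 1. \<Sum>i<2 * l + 1. (fourier_weight l m j
          * cis (of_int \<mu> * fourier_node l j)) *
          cnj (fourier_weight l m' i * cis (of_int \<mu> * fourier_node l i)))" for \<mu>
        by (simp only: cnj_sum sum_product)
      thus ?thesis by (simp only: sum_distrib_left)
    qed
    also have "\<dots> = (\<Sum>\<mu> = -int l..int l. if \<mu> = m then (if m = m' then 1 else 0) else 0)"
    proof (intro sum.cong refl)
      fix \<mu> assume "\<mu> \<in> {- int l..int l}"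
      hence mu: "\<bar>\<mu>\<bar> \<le> int l" by auto
      have sq: "complex_of_real ((harm_coeff l m)\<^sup>2) * (1 / of_real (harm_coeff l m)
          * cnj (1 / of_real (harm_coeff l m))) = 1"
        using harm_coeff_nonzero[of l m] by (simp add: power2_eq_square)
      show "of_real ((harm_coeff l \<mu>)\<^sup>2) * (?f m \<mu> * cnj (?f m' \<mu>)) = (if \<mu> = m then (if m
          = m' then 1 else 0) else 0)"
        unfolding fourier_weight_dual[OF assms(1) mu] fourier_weight_dual[OF m' mu] using sq by auto
    qed
    also have "\<dots> = (if m = m' then 1 else 0)"
      using assms(1) by (subst sum.delta) auto
    finally show ?thesis unfolding null_vec_moments by simp
  qed
  finally show ?thesis .
qed

lemma Funk_Hecke_power:
  assumes "\<bar>m\<bar> \<le> int l" "x \<in> sphere 0 1"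
  shows "sphere_integral (\<lambda>y. of_real ((x \<bullet> y) ^ n) * sph_harm l m y)
      = of_real (null_moment n l) * sph_harm l m x"
proof -
  have "sphere_integral (\<lambda>y. of_real ((x \<bullet> y) ^ n) * sph_harm l m y)
    = sphere_integral (\<lambda>y. \<Sum>j<2 * l + 1. fourier_weight l m j *
         (of_real ((x \<bullet> y) ^ n) * cdot (null_vec (fourier_node l j)) (cvec y) ^ l))"
    by (rule sphere_integral_cong) (simp only: sph_harm_null_powers[OF assms(1)] sum_distrib_left
        mult_ac)
  also have "\<dots> = (\<Sum>j<2 * l + 1. fourier_weight l m j *
         (of_real (null_moment n l) * cdot (null_vec (fourier_node l j)) (cvec x) ^ l))"
    by (subst sphere_integral_sum, (intro continuous_intros)[1], intro sum.cong refl,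
        subst sphere_integral_mult_left, (intro continuous_intros)[1])
       (simp only: sphere_moment_zonal[OF cdot_null_vec assms(2)])
  also have "\<dots> = of_real (null_moment n l) * sph_harm l m x"
    unfolding sph_harm_null_powers[OF assms] sum_distrib_left by (simp only: mult_ac)
  finally show ?thesis .
qed

lemma has_integral_sin_comp_cos:
  fixes f :: "real \<Rightarrow> real"
  assumes "continuous_on {-1..1} f"
  shows "((\<lambda>\<theta>. sin \<theta> * f (cos \<theta>)) has_integral integral {-1..1} f) {0..pi}"
proof -
  have "((\<lambda>\<theta>. sin \<theta> *\<^sub>R f (- (- cos \<theta>))) has_integral
      integral {- cos 0..- cos pi} (\<lambda>s. f (- s))) {0..pi}"
  proof (rule has_integral_substitution[where g = "\<lambda>\<theta>. - cos \<theta>" and c = "-1" and d = 1])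
    show "continuous_on {-1..1} (\<lambda>s. f (- s))"
      by (rule continuous_on_compose2[OF assms]) (auto intro!: continuous_intros)
    show "((\<lambda>\<theta>. - cos \<theta>) has_real_derivative sin \<theta>) (at \<theta> within {0..pi})" for \<theta>
      by (auto intro!: derivative_eq_intros)
  qed auto
  moreover have "integral {-1..1} (\<lambda>s. f (- s)) = integral {-1..1} f"
    using Henstock_Kurzweil_Integration.integral_reflect_real[of 1 "-1" f]
        by (simp only: minus_minus)
  ultimately show ?thesis by (simp only: cos_zero cos_pi minus_minus real_scaleR_def)
qed

text \<open>
  The constant in \<open>sphere_moment_zonal\<close> may be computed at the north pole, where the integral over
  the azimuth is Laplace's integral for the Legendre polynomial.
\<close>

lemma null_moment_legendre:
  "null_moment n l = 2 * pi * integral {-1..1} (\<lambda>s. s ^ n * poly (legendre l) s)"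
proof -
  define e where "e = sph_point 0 0"
  have e: "e \<in> sphere 0 1" unfolding e_def by (rule sph_point_in_sphere)
  have 1: "cdot (null_vec 0) (cvec e) = 1"
    by (simp add: cdot_def null_vec_def cvec_def e_def sph_point_def sum_3)
  have inner: "((\<lambda>\<phi>. sin \<theta> *\<^sub>R (of_real ((e \<bullet> sph_point \<theta> \<phi>) ^ n)
      * cdot (null_vec 0) (cvec (sph_point \<theta> \<phi>)) ^ l))
      has_integral of_real (2 * pi * (sin \<theta> * (cos \<theta> ^ n * poly (legendre l) (cos \<theta>))))) {-pi..pi}"
    if "\<theta> \<in> {0..pi}" for \<theta>
  proof -
    have s: "sqrt (1 - (cos \<theta>)\<^sup>2) = sin \<theta>"
      using sin_ge_zero[of \<theta>] that by (simp add: sin_squared_eq[symmetric])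
    have d: "e \<bullet> sph_point \<theta> \<phi> = cos \<theta>" for \<phi>
      by (simp add: e_def sph_point_def inner_vec_def sum_3)
    define a where "a j = (of_real ((-1) ^ (j + l) * fact l / fact j
        * assoc_legendre l (int j - int l) (cos \<theta>)) :: complex)" for j
    have z: "cdot (null_vec 0) (cvec (sph_point \<theta> \<phi>))
        = of_real (cos \<theta>) + \<i> * of_real (sqrt (1 - (cos \<theta>)\<^sup>2) * sin \<phi>)" for \<phi>
      unfolding s by (simp add: cdot_def null_vec_def cvec_def sph_point_def sum_3)
    have p: "cdot (null_vec 0) (cvec (sph_point \<theta> \<phi>)) ^ l
        = (\<Sum>j\<le>2 * l. a j * exp (\<i> * of_int (int j - int l) * of_real \<phi>))" for \<phi>
    proof -
      have "cis (of_int k * \<phi>) = exp (\<i> * of_int k * of_real \<phi>)" for k :: int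
        by (simp add: cis_conv_exp mult_ac)
      thus ?thesis unfolding z a_def
        by (simp only: Laplace_assoc_legendre[OF cos_ge_minus_one cos_le_one])
    qed
    have "((\<lambda>\<phi>. sin \<theta> *\<^sub>R (of_real (cos \<theta> ^ n) * (\<Sum>j\<le>2 * l. a j * exp (\<i> * of_int (int j - int l)
        * of_real \<phi>)))) has_integral
       sin \<theta> *\<^sub>R (of_real (cos \<theta> ^ n) * (\<Sum>j\<le>2 * l. a j * (if int j - int l
           = 0 then of_real (2 * pi) else 0)))) {-pi..pi}"
      by (intro has_integral_cmul has_integral_mult_right has_integral_sum finite_atMost
          has_integral_exp_int)
    also have "(\<Sum>j\<le>2 * l. a j * (if int j - int l = 0 then of_real (2 * pi) else 0))
        = (\<Sum>j\<le>2 * l. if j = l then a l * of_real (2 * pi) else 0)"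
      by (intro sum.cong refl) auto
    also have "\<dots> = a l * of_real (2 * pi)" by (subst sum.delta) auto
    also have "a l = of_real (poly (legendre l) (cos \<theta>))"
      by (simp add: a_def assoc_legendre_0)
    also have "sin \<theta> *\<^sub>R (of_real (cos \<theta> ^ n) * (of_real (poly (legendre l) (cos \<theta>)) * of_real (2
        * pi)))
       = complex_of_real (2 * pi * (sin \<theta> * (cos \<theta> ^ n * poly (legendre l) (cos \<theta>))))"
      by (simp add: scaleR_conv_of_real)
    finally show ?thesis unfolding d p .
  qed
  have "complex_of_real (null_moment n l)
     = sphere_integral (\<lambda>y. of_real ((e \<bullet> y) ^ n) * cdot (null_vec 0) (cvec y) ^ l)"
    unfolding sphere_moment_zonal[OF cdot_null_vec e] 1 by simp
  also have "\<dots> = integral {0..pi} (\<lambda>\<theta>. complex_of_real (2 * pi * (sin \<theta> * (cos \<theta> ^ n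
      * poly (legendre l) (cos \<theta>)))))"
    unfolding sphere_integral_def by (intro integral_cong integral_unique inner)
  also have "\<dots> = of_real (2 * pi * integral {-1..1} (\<lambda>s. s ^ n * poly (legendre l) s))"
  proof (rule integral_unique)
    have "((\<lambda>\<theta>. 2 * pi * (sin \<theta> * (cos \<theta> ^ n * poly (legendre l) (cos \<theta>)))) has_integral
       2 * pi * integral {-1..1} (\<lambda>s. s ^ n * poly (legendre l) s)) {0..pi}"
      by (intro has_integral_mult_right has_integral_sin_comp_cos continuous_intros)
    from has_integral_linear[OF this bounded_linear_of_real[where ?'a = complex]]
    show "((\<lambda>\<theta>. complex_of_real (2 * pi * (sin \<theta> * (cos \<theta> ^ n * poly (legendre l) (cos \<theta>)))))
       has_integral of_real (2 * pi * integral {-1..1} (\<lambda>s. s ^ n * poly (legendre l) s))) {0..pi}"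
      unfolding o_def .
  qed
  finally show ?thesis by (simp only: of_real_eq_iff)
qed

lemma inner_sphere_bounds:
  fixes x y :: "real ^ 3"
  assumes "x \<in> sphere 0 1" "y \<in> sphere 0 1"
  shows "-1 \<le> x \<bullet> y" "x \<bullet> y \<le> 1"
  using Cauchy_Schwarz_ineq2[of x y] assms by auto

lemma continuous_on_zonal:
  assumes "continuous_on {-1..1} g" "x \<in> sphere 0 1"
  shows "continuous_on (sphere 0 1) (\<lambda>y :: real ^ 3. g (x \<bullet> y))"
  by (rule continuous_on_compose2[OF assms(1)])
     (use inner_sphere_bounds[OF assms(2)] in \<open>auto intro!: continuous_intros\<close>)

text \<open>
  Both sides are linear in \<open>g\<close> and continuous in the uniform norm on \<open>[-1, 1]\<close>; they agree for
  powers, hence for polynomials, hence, by Weierstrass approximation, for all continuous \<open>g\<close>.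
\<close>

lemma Funk_Hecke:
  fixes g :: "real \<Rightarrow> real"
  assumes m: "\<bar>m\<bar> \<le> int l" and x: "x \<in> sphere 0 1" and g: "continuous_on {-1..1} g"
  shows "sphere_integral (\<lambda>y. of_real (g (x \<bullet> y)) * sph_harm l m y)
     = of_real (2 * pi * integral {-1..1} (\<lambda>s. g s * poly (legendre l) s)) * sph_harm l m x"
proof -
  let ?Y = "sph_harm l m" and ?P = "poly (legendre l)"
  define I where "I h = sphere_integral (\<lambda>y. of_real (h (x \<bullet> y)) * ?Y y)" for h :: "real \<Rightarrow> real"
  define J where "J h = of_real (2 * pi * integral {-1..1} (\<lambda>s. h s * ?P s)) * ?Y x" for h
  have ip: "x \<bullet> y \<in> {-1..1}" if "y \<in> sphere 0 1" for y
    using inner_sphere_bounds[OF x that] by simp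
  have cont: "continuous_on (sphere 0 1) (\<lambda>y. of_real (h (x \<bullet> y)) * ?Y y)"
      if "continuous_on {-1..1} h" for h :: "real \<Rightarrow> real"
  proof -
    have "continuous_on (sphere 0 1) (\<lambda>y. h (x \<bullet> y))"
      by (rule continuous_on_zonal[OF that x])
    thus ?thesis by (intro continuous_intros continuous_on_sph_harm m)
  qed
  have contP: "continuous_on {-1..1} (\<lambda>s. h s * ?P s)" if "continuous_on {-1..1} h" for h
    by (intro continuous_intros that)
  have poly_case: "I h = J h" if h: "real_polynomial_function h" for h
  proof -
    obtain a N where h: "h = (\<lambda>s. \<Sum>i\<le>N. a i * s ^ i)"
      using h real_polynomial_function_iff_sum by blast
    have "I h = sphere_integral (\<lambda>y. \<Sum>i\<le>N. of_real (a i) * (of_real ((x \<bullet> y) ^ i) * ?Y y))"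
      unfolding I_def h by (simp add: sum_distrib_right mult.assoc)
    also have "\<dots> = (\<Sum>i\<le>N. of_real (a i) * (of_real (null_moment i l) * ?Y x))"
      by (subst sphere_integral_sum, (intro continuous_intros continuous_on_sph_harm m)[1], intro
          sum.cong refl,
          subst sphere_integral_mult_left, (intro continuous_intros continuous_on_sph_harm m)[1])
         (simp only: Funk_Hecke_power[OF m x])
    also have "\<dots> = of_real (\<Sum>i\<le>N. a i * null_moment i l) * ?Y x"
      by (simp add: sum_distrib_right mult.assoc)
    also have "(\<Sum>i\<le>N. a i * null_moment i l)
        = 2 * pi * (\<Sum>i\<le>N. integral {-1..1} (\<lambda>s. a i * (s ^ i * ?P s)))"
      unfolding null_moment_legendre by (simp add: sum_distrib_left mult_ac)
    also have "(\<Sum>i\<le>N. integral {-1..1} (\<lambda>s. a i * (s ^ i * ?P s)))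
        = integral {-1..1} (\<lambda>s. h s * ?P s)"
      unfolding h sum_distrib_right mult.assoc
      by (rule integral_sum[symmetric]) (auto intro!: integrable_continuous_interval
          continuous_intros)
    finally show ?thesis unfolding J_def .
  qed
  have "bounded (?Y ` sphere 0 1)"
    by (intro compact_imp_bounded compact_continuous_image continuous_on_sph_harm m) auto
  then obtain B where B: "0 < B" "\<And>y. y \<in> sphere 0 1 \<Longrightarrow> norm (?Y y) \<le> B"
    unfolding bounded_pos by blast
  have "bounded (?P ` {-1..1})"
    by (intro compact_imp_bounded compact_continuous_image continuous_intros) auto
  then obtain C where C: "0 < C" "\<And>s. s \<in> {-1..1} \<Longrightarrow> norm (?P s) \<le> C"
    unfolding bounded_pos by blast
  \<comment> \<open>replacing \<open>g\<close> by a polynomial within \<open>e\<close> of it changes both sides by at most \<open>e * K\<close> together\<close>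
  define K where "K = B * (2 * pi\<^sup>2) + 2 * pi * (2 * C) * B"
  have K: "0 < K" using B C by (auto simp: K_def intro!: add_pos_pos mult_pos_pos)
  have close: "norm (I g - J g) \<le> e * K" if "0 < e" for e
  proof -
    obtain h where h: "real_polynomial_function h" "\<And>s. s \<in> {-1..1} \<Longrightarrow> \<bar>g s - h s\<bar> < e"
      using Stone_Weierstrass_real_polynomial_function[OF compact_Icc g \<open>0 < e\<close>] by metis
    have ch: "continuous_on {-1..1} h"
      using h(1) continuous_polymonial_function continuous_at_imp_continuous_on
          real_polynomial_function_eq by blast
    have eh: "\<bar>g s - h s\<bar> \<le> e" if "s \<in> {-1..1}" for s using h(2)[OF that] by simp
    have "I g - I h = sphere_integral (\<lambda>y. of_real (g (x \<bullet> y) - h (x \<bullet> y)) * ?Y y)"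
    proof -
      have cd: "continuous_on {-1..1} (\<lambda>s. g s - h s)" by (intro continuous_intros g ch)
      have "I g = sphere_integral (\<lambda>y. of_real (h (x \<bullet> y)) * ?Y y
          + of_real (g (x \<bullet> y) - h (x \<bullet> y)) * ?Y y)"
        unfolding I_def by (simp add: algebra_simps)
      also have "\<dots> = I h + sphere_integral (\<lambda>y. of_real (g (x \<bullet> y) - h (x \<bullet> y)) * ?Y y)"
        unfolding I_def by (rule sphere_integral_add[OF cont[OF ch] cont[OF cd]])
      finally have "I g = I h + sphere_integral (\<lambda>y. of_real (g (x \<bullet> y) - h (x \<bullet> y)) * ?Y y)" .
      thus ?thesis by simp
    qed
    also have "norm \<dots> \<le> (e * B) * (2 * pi\<^sup>2)"
    proof (rule sphere_integral_norm_le)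
      show "continuous_on (sphere 0 1) (\<lambda>y. of_real (g (x \<bullet> y) - h (x \<bullet> y)) * ?Y y)"
        by (rule cont[of "\<lambda>s. g s - h s"]) (intro continuous_intros g ch)
      show "norm (of_real (g (x \<bullet> y) - h (x \<bullet> y)) * ?Y y) \<le> e * B" if "y \<in> sphere 0 1" for y
        unfolding norm_mult norm_of_real using eh[OF ip[OF that]] B(2)[OF that] \<open>0 < e\<close>
        by (intro mult_mono) auto
    qed
    finally have 1: "norm (I g - I h) \<le> e * B * (2 * pi\<^sup>2)" .
    have "integral {-1..1} (\<lambda>s. g s * ?P s) - integral {-1..1} (\<lambda>s. h s * ?P s)
        = integral {-1..1} (\<lambda>s. (g s - h s) * ?P s)"
      by (subst integral_diff[symmetric]) (auto intro!: integrable_continuous_interval contP g ch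
          simp: left_diff_distrib)
    moreover have "norm (integral {-1..1} (\<lambda>s. (g s - h s) * ?P s)) \<le> e * C * (1 - (-1))"
    proof (rule integral_bound)
      show "continuous_on {-1..1} (\<lambda>s. (g s - h s) * ?P s)" by (intro continuous_intros g ch)
      show "norm ((g s - h s) * ?P s) \<le> e * C" if "s \<in> {-1..1}" for s
        unfolding norm_mult using eh[OF that] C(2)[OF that] \<open>0 < e\<close> by (intro mult_mono) auto
    qed simp
    ultimately have d: "\<bar>integral {-1..1} (\<lambda>s. h s * ?P s) - integral {-1..1} (\<lambda>s. g s * ?P s)\<bar>
        \<le> e * (2 * C)"
      by (simp add: abs_minus_commute mult_ac)
    have "J h - J g = of_real (2 * pi * (integral {-1..1} (\<lambda>s. h s
        * ?P s) - integral {-1..1} (\<lambda>s. g s * ?P s))) * ?Y x"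
      unfolding J_def by (simp add: algebra_simps)
    also have "norm \<dots> \<le> (2 * pi * (e * (2 * C))) * B"
      unfolding norm_mult norm_of_real abs_mult using d B(2)[OF x] \<open>0 < e\<close> C(1)
      by (intro mult_mono) auto
    finally have 2: "norm (J h - J g) \<le> e * (2 * pi * (2 * C) * B)" by (simp add: mult_ac)
    have "I g - J g = (I g - I h) + (J h - J g)" using poly_case[OF h(1)] by simp
    hence "norm (I g - J g) \<le> norm (I g - I h) + norm (J h - J g)" by (metis norm_triangle_ineq)
    also have "\<dots> \<le> e * K" using 1 2 by (simp add: K_def algebra_simps)
    finally show ?thesis .
  qed
  have "norm (I g - J g) \<le> 0"
  proof (rule field_le_epsilon)
    fix e :: real assume "0 < e"
    thus "norm (I g - J g) \<le> 0 + e" using close[of "e / K"] K by simp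
  qed
  thus ?thesis by (simp add: I_def J_def)
qed

section \<open>Packing of spherical caps\<close>

text \<open>
  The Funk--Hecke formula for the constant harmonic \<open>Y\<^sub>0\<^sup>0\<close>; for indicator functions this would be
  the formula of Archimedes for the area of a cap.
\<close>

lemma zonal_integral:
  fixes g :: "real \<Rightarrow> real"
  assumes "continuous_on {-1..1} g" "x \<in> sphere 0 1"
  shows "sphere_integral (\<lambda>y. g (x \<bullet> y)) = 2 * pi * integral {-1..1} g"
proof -
  define c :: complex where "c = of_real (sqrt (1 / (4 * pi)))"
  have c0: "c \<noteq> 0" by (simp add: c_def)
  have Y: "sph_harm 0 0 y = c" for y
    by (simp add: sph_harm_def sph_harm_ang_def assoc_legendre_0 c_def)
  have cont: "continuous_on (sphere 0 1) (\<lambda>y. g (x \<bullet> y))"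
    by (rule continuous_on_zonal[OF assms])
  have "sphere_integral (\<lambda>y. of_real (g (x \<bullet> y)) * c) = of_real (2 * pi * integral {-1..1} g) * c"
    using Funk_Hecke[of 0 0 x g] assms unfolding Y by simp
  moreover have "sphere_integral (\<lambda>y. of_real (g (x \<bullet> y)) * c)
      = of_real (sphere_integral (\<lambda>y. g (x \<bullet> y))) * c"
    by (rule sphere_integral_linear[OF cont, of "\<lambda>r. of_real r * c"])
       (intro bounded_linear_compose[OF bounded_linear_mult_left bounded_linear_of_real])
  ultimately show ?thesis using c0 by (simp only: mult_cancel_right of_real_eq_iff) simp
qed

text \<open>
  After splitting off the components along \<open>y\<close>, the Cauchy--Schwarz inequality bounds \<open>\<langle>x, z\<rangle>\<close>
  below by the cosine of the sum of the angles \<open>\<angle>(x, y)\<close> and \<open>\<angle>(y, z)\<close>.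
\<close>

lemma spherical_triangle_inequality:
  fixes x y z :: "real ^ 3"
  assumes "x \<in> sphere 0 1" "y \<in> sphere 0 1" "z \<in> sphere 0 1"
    and "0 \<le> a" "0 \<le> b" "a + b \<le> pi" "cos a < x \<bullet> y" "cos b < y \<bullet> z"
  shows "cos (a + b) < x \<bullet> z"
proof -
  have n: "x \<bullet> x = 1" "y \<bullet> y = 1" "z \<bullet> z = 1"
    using assms(1-3) by (simp_all add: dot_square_norm)
  define p q where "p = x \<bullet> y" and "q = y \<bullet> z"
  have pb: "-1 \<le> p" "p \<le> 1" and qb: "-1 \<le> q" "q \<le> 1"
    using inner_sphere_bounds assms(1-3) by (auto simp: p_def q_def)
  have "\<bar>(x - p *\<^sub>R y) \<bullet> (z - q *\<^sub>R y)\<bar> \<le> norm (x - p *\<^sub>R y) * norm (z - q *\<^sub>R y)"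
    by (rule Cauchy_Schwarz_ineq2)
  also have "norm (x - p *\<^sub>R y) = sqrt (1 - p\<^sup>2)"
    unfolding norm_eq_sqrt_inner using n
    by (simp add: inner_diff_left inner_diff_right p_def inner_commute power2_eq_square)
  also have "norm (z - q *\<^sub>R y) = sqrt (1 - q\<^sup>2)"
    unfolding norm_eq_sqrt_inner using n
    by (simp add: inner_diff_left inner_diff_right q_def inner_commute power2_eq_square)
  also have "(x - p *\<^sub>R y) \<bullet> (z - q *\<^sub>R y) = x \<bullet> z - p * q"
    using n by (simp add: inner_diff_left inner_diff_right p_def q_def inner_commute)
  finally have "p * q - sqrt (1 - p\<^sup>2) * sqrt (1 - q\<^sup>2) \<le> x \<bullet> z" by linarith
  moreover have "cos (arccos p + arccos q) = p * q - sqrt (1 - p\<^sup>2) * sqrt (1 - q\<^sup>2)"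
    using pb qb by (simp add: cos_add sin_arccos)
  ultimately have 1: "cos (arccos p + arccos q) \<le> x \<bullet> z" by simp
  have "arccos p < arccos (cos a)"
    using assms pb by (intro arccos_less_arccos) (auto simp: p_def)
  hence "arccos p < a" using assms by (simp add: arccos_cos)
  moreover have "arccos q < arccos (cos b)"
    using assms qb by (intro arccos_less_arccos) (auto simp: q_def)
  hence "arccos q < b" using assms by (simp add: arccos_cos)
  ultimately have "cos (a + b) < cos (arccos p + arccos q)"
    using assms arccos_lbound[OF pb] arccos_lbound[OF qb]
    by (intro cos_monotone_0_pi) auto
  thus ?thesis using 1 by simp
qed

text \<open>
  A continuous substitute for the indicator function of \<open>s > c\<close>: \<open>sphere_integral\<close> is used for
  continuous functions only, so the areas of caps are reached by letting \<open>e\<close> tend to 0.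
\<close>

definition ramp :: "real \<Rightarrow> real \<Rightarrow> real \<Rightarrow> real" where
  "ramp c e s = max 0 (min 1 ((s - c) / e))"

lemma continuous_on_ramp: "e \<noteq> 0 \<Longrightarrow> continuous_on S (ramp c e)"
  unfolding ramp_def by (intro continuous_intros) auto

lemma ramp_bounds: "0 \<le> ramp c e s" "ramp c e s \<le> 1"
  by (auto simp: ramp_def)

lemma ramp_eq_0: "0 < e \<Longrightarrow> s \<le> c \<Longrightarrow> ramp c e s = 0"
  by (auto simp: ramp_def divide_nonpos_pos min_def)

lemma ramp_eq_1: "0 < e \<Longrightarrow> c + e \<le> s \<Longrightarrow> ramp c e s = 1"
  by (auto simp: ramp_def le_divide_eq)

lemma integral_ramp_lower:
  assumes "0 < e" "-1 \<le> c" "c + e \<le> 1"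
  shows "1 - (c + e) \<le> integral {-1..1} (ramp c e)"
proof -
  have i: "ramp c e integrable_on {a..b}" for a b
    using assms by (intro integrable_continuous_interval continuous_on_ramp) auto
  have "1 - (c + e) = integral {c + e..1} (\<lambda>s. 1 :: real)" using assms by simp
  also have "\<dots> = integral {c + e..1} (ramp c e)"
    by (rule integral_cong) (simp add: ramp_eq_1 assms)
  also have "\<dots> \<le> integral {-1..1} (ramp c e)"
    by (rule integral_subset_le) (use assms i ramp_bounds in auto)
  finally show ?thesis .
qed

lemma integral_ramp_upper:
  assumes "0 < e" "-1 \<le> c + e" "c + e \<le> 1"
  shows "integral {-1..1} (ramp c e) \<le> 1 - c"
proof -
  have i: "ramp c e integrable_on {a..b}" for a b
    using assms by (intro integrable_continuous_interval continuous_on_ramp) auto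
  define d where "d = max (-1) c"
  have d: "-1 \<le> d" "d \<le> 1" "c \<le> d" using assms by (auto simp: d_def)
  have "integral {-1..d} (ramp c e) = integral {-1..d} (\<lambda>s. 0 :: real)"
    by (rule integral_spike[of "{-1}"]) (use assms in \<open>auto
        simp: d_def max_def ramp_eq_0 split: if_splits\<close>)
  moreover have "integral {d..1} (ramp c e) \<le> integral {d..1} (\<lambda>s. 1 :: real)"
    by (rule integral_le) (use i ramp_bounds in auto)
  ultimately show ?thesis using Henstock_Kurzweil_Integration.integral_combine[OF d(1,2) i] d by
      simp
qed

text \<open>
  The open caps of radius \<open>\<theta>/2\<close> about the points \<open>x\<^sub>k\<close> are disjoint and contained in the cap of
  radius \<open>\<theta>/2 + \<omega>\<close> about \<open>y\<close>; a cap of radius \<open>\<rho>\<close> has area \<open>2\<pi>(1 - cos \<rho>)\<close>. Each small cap is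
  replaced by a ramp from below and the large one by a ramp from above, at the cost of an error of
  order \<open>e\<close>.
\<close>

lemma spherical_packing:
  fixes x :: "'i \<Rightarrow> real ^ 3"
  assumes fin: "finite K" and \<theta>: "0 < \<theta>" "\<theta> \<le> pi" and \<omega>: "0 \<le> \<omega>" "\<omega> \<le> pi / 2"
    and x: "\<And>k. k \<in> K \<Longrightarrow> x k \<in> sphere 0 1" and y: "y \<in> sphere 0 1"
    and sep: "\<And>k l. k \<in> K \<Longrightarrow> l \<in> K \<Longrightarrow> k \<noteq> l \<Longrightarrow> x k \<bullet> x l \<le> cos \<theta>"
    and near: "\<And>k. k \<in> K \<Longrightarrow> cos \<omega> < x k \<bullet> y"
  shows "real (card K) * (1 - cos (\<theta> / 2)) \<le> 1 - cos (\<theta> / 2 + \<omega>)"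
proof (rule field_le_epsilon)
  fix d :: real assume d: "0 < d"
  define c c' where "c = cos (\<theta> / 2)" and "c' = cos (\<theta> / 2 + \<omega>)"
  have "c < cos 0" unfolding c_def using \<theta> by (intro cos_monotone_0_pi) auto
  hence c1: "c < 1" by simp
  \<comment> \<open>each ramp costs at most \<open>e\<close>, hence \<open>d\<close> in total; \<open>c + e
      \<le> 1\<close> keeps the top of the inner ramps inside \<open>[-1, 1]\<close>\<close>
  define e where "e = min (d / (1 + real (card K))) (1 - c)"
  have e: "0 < e" "c + e \<le> 1" using d c1 by (auto simp: e_def)
  have ed: "e * (1 + real (card K)) \<le> d"
  proof -
    have "e \<le> d / (1 + real (card K))" by (simp add: e_def)
    thus ?thesis by (simp add: pos_le_divide_eq)
  qed
  have pointwise: "(\<Sum>k\<in>K. ramp c e (x k \<bullet> z))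
      \<le> ramp (c' - e) e (y \<bullet> z)" if z: "z \<in> sphere 0 1" for z
  proof (cases "\<exists>k\<in>K. c < x k \<bullet> z")
    case False
    hence "(\<Sum>k\<in>K. ramp c e (x k \<bullet> z)) = 0"
      by (intro sum.neutral) (auto simp: ramp_eq_0 e not_less)
    thus ?thesis using ramp_bounds by simp
  next
    case True
    then obtain k where k: "k \<in> K" "c < x k \<bullet> z" by blast
    have others: "ramp c e (x j \<bullet> z) = 0" if "j \<in> K - {k}" for j
    proof (rule ramp_eq_0[OF e(1)], rule ccontr)
      assume "\<not> x j \<bullet> z \<le> c"
      hence "cos (\<theta> / 2 + \<theta> / 2) < x j \<bullet> x k"
        using that k \<theta> x z
        by (intro spherical_triangle_inequality[of _ z]) (auto simp: c_def inner_commute)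
      thus False using sep[of j k] that k by simp
    qed
    have "(\<Sum>j\<in>K. ramp c e (x j \<bullet> z)) = ramp c e (x k \<bullet> z) + (\<Sum>j\<in>K - {k}. ramp c e (x j \<bullet> z))"
      by (rule sum.remove[OF fin k(1)])
    also have "\<dots> \<le> 1" using others ramp_bounds by simp
    also have "1 = ramp (c' - e) e (y \<bullet> z)"
    proof -
      have "cos (\<omega> + \<theta> / 2) < y \<bullet> z"
        using k \<theta> \<omega> x y z near[OF k(1)]
        by (intro spherical_triangle_inequality[of _ "x k"]) (auto simp: c_def inner_commute)
      thus ?thesis using e by (subst ramp_eq_1) (auto simp: c'_def add.commute)
    qed
    finally show ?thesis .
  qed
  have ramp_cont: "continuous_on {-1..1} (ramp b e)" for b
    using e by (intro continuous_on_ramp) auto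
  have "real (card K) * (2 * pi * (1 - (c + e))) \<le> (\<Sum>k\<in>K. 2 * pi * integral {-1..1} (ramp c e))"
  proof -
    have "1 - (c + e) \<le> integral {-1..1} (ramp c e)"
      by (rule integral_ramp_lower) (use e in \<open>auto simp: c_def\<close>)
    thus ?thesis by (simp add: mult_left_mono)
  qed
  also have "\<dots> = (\<Sum>k\<in>K. sphere_integral (\<lambda>z. ramp c e (x k \<bullet> z)))"
    by (intro sum.cong refl zonal_integral[symmetric] ramp_cont x)
  also have "\<dots> = sphere_integral (\<lambda>z. \<Sum>k\<in>K. ramp c e (x k \<bullet> z))"
    by (rule sphere_integral_sum[symmetric]) (intro continuous_on_zonal ramp_cont x)
  also have "\<dots> \<le> sphere_integral (\<lambda>z. ramp (c' - e) e (y \<bullet> z))"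
    by (intro sphere_integral_mono continuous_on_sum continuous_on_zonal ramp_cont x y pointwise)
  also have "\<dots> = 2 * pi * integral {-1..1} (ramp (c' - e) e)"
    by (intro zonal_integral ramp_cont y)
  also have "\<dots> \<le> 2 * pi * (1 - (c' - e))"
    by (intro mult_left_mono integral_ramp_upper) (use e in \<open>auto simp: c'_def\<close>)
  finally have "2 * pi * (real (card K) * (1 - (c + e))) \<le> 2 * pi * (1 - (c' - e))"
      by (simp add: mult_ac)
  hence "real (card K) * (1 - (c + e)) \<le> 1 - (c' - e)" by simp
  hence "real (card K) * (1 - c) \<le> 1 - c' + e * (1 + real (card K))" by (simp add: algebra_simps)
  thus "real (card K) * (1 - cos (\<theta> / 2)) \<le> 1 - cos (\<theta> / 2 + \<omega>) + d"
    using ed by (simp add: c_def c'_def)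
qed

section \<open>The large sieve inequality\<close>

lemma sph_harm_Parseval:
  assumes "finite H" and H: "\<And>p. p \<in> H \<Longrightarrow> \<bar>snd p\<bar> \<le> int (fst p)"
  shows "sphere_integral (\<lambda>y. (cmod (\<Sum>p\<in>H. b p * sph_harm (fst p) (snd p) y))\<^sup>2)
      = (\<Sum>p\<in>H. (cmod (b p))\<^sup>2)"
proof -
  let ?Y = "\<lambda>p. sph_harm (fst p) (snd p)"
  let ?T = "\<lambda>y. \<Sum>p\<in>H. b p * ?Y p y"
  have cY: "continuous_on (sphere 0 1) (?Y p)" if "p \<in> H" for p
    using continuous_on_sph_harm H[OF that] .
  have cT: "continuous_on (sphere 0 1) ?T"
    by (intro continuous_intros cY)
  have "complex_of_real (sphere_integral (\<lambda>y. (cmod (?T y))\<^sup>2))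
      = sphere_integral (\<lambda>y. complex_of_real ((cmod (?T y))\<^sup>2))"
    by (rule sphere_integral_linear[symmetric]) (intro continuous_intros cT bounded_linear_of_real)+
  also have "\<dots> = sphere_integral (\<lambda>y. \<Sum>p\<in>H. \<Sum>q\<in>H. (b p * cnj (b q)) * (?Y p y * cnj (?Y q y)))"
    unfolding complex_norm_square cnj_sum sum_product by (simp add: mult_ac)
  also have "\<dots> = (\<Sum>p\<in>H. \<Sum>q\<in>H. (b p * cnj (b q)) * sphere_integral (\<lambda>y. ?Y p y * cnj (?Y q y)))"
    by (subst sphere_integral_sum, (intro continuous_intros cY; assumption)[1], intro sum.cong refl,
        subst sphere_integral_sum, (intro continuous_intros cY; assumption)[1], intro sum.cong refl,
        rule sphere_integral_mult_left, intro continuous_intros cY; assumption)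
  also have "\<dots> = (\<Sum>p\<in>H. \<Sum>q\<in>H. if q = p then b p * cnj (b p) else 0)"
    by (intro sum.cong refl) (subst sph_harm_orthonormal, auto simp: H prod_eq_iff)
  also have "\<dots> = (\<Sum>p\<in>H. b p * cnj (b p))"
    using assms(1) by (simp add: sum.delta)
  also have "\<dots> = of_real (\<Sum>p\<in>H. (cmod (b p))\<^sup>2)"
    by (simp only: of_real_sum complex_norm_square)
  finally show ?thesis by (simp only: of_real_eq_iff)
qed

lemma sum_squared_sparse:
  fixes f :: "'i \<Rightarrow> 'a :: real_normed_vector"
  assumes "finite A" "K \<subseteq> A" "\<And>k. k \<in> A - K \<Longrightarrow> f k = 0" "real (card K) \<le> N"
  shows "(norm (\<Sum>k\<in>A. f k))\<^sup>2 \<le> N * (\<Sum>k\<in>A. (norm (f k))\<^sup>2)"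
proof -
  have "(\<Sum>k\<in>A. f k) = (\<Sum>k\<in>K. f k)"
    by (rule sum.mono_neutral_right) (use assms in auto)
  hence "(norm (\<Sum>k\<in>A. f k))\<^sup>2 \<le> (\<Sum>k\<in>K. norm (f k))\<^sup>2"
    by (simp add: power_mono sum_norm_le)
  also have "\<dots> \<le> (\<Sum>k\<in>K. (norm (f k))\<^sup>2) * real (card K)"
    by (rule sum_squared_le_sum_of_squares)
  also have "\<dots> \<le> (\<Sum>k\<in>K. (norm (f k))\<^sup>2) * N"
    using assms(4) by (intro mult_left_mono sum_nonneg) auto
  also have "\<dots> \<le> (\<Sum>k\<in>A. (norm (f k))\<^sup>2) * N"
  proof (rule mult_right_mono)
    show "(\<Sum>k\<in>K. (norm (f k))\<^sup>2) \<le> (\<Sum>k\<in>A. (norm (f k))\<^sup>2)"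
      by (rule sum_mono2) (use assms in auto)
    show "0 \<le> N" using assms(4) by (rule order_trans[rotated]) simp
  qed
  finally show ?thesis by (simp add: mult.commute)
qed

text \<open>
  The Cauchy--Schwarz inequality for an integral of \<open>h T\<close>, used in the linearised form in which it
  follows pointwise.
\<close>

lemma Re_mult_le_squares:
  assumes "0 < c"
  shows "Re (h * T) \<le> (cmod h)\<^sup>2 / (2 * c) + c / 2 * (cmod T)\<^sup>2"
proof -
  have "Re (h * T) \<le> cmod h * cmod T"
    using complex_Re_le_cmod[of "h * T"] by (simp add: norm_mult)
  also have "0 \<le> (cmod h - c * cmod T)\<^sup>2 / (2 * c)" using assms by simp
  hence "cmod h * cmod T \<le> (cmod h)\<^sup>2 / (2 * c) + c / 2 * (cmod T)\<^sup>2"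
    using assms by (simp add: field_simps power2_eq_square)
  finally show ?thesis .
qed

text \<open>
  Replacing \<open>s\<close> by \<open>max s t\<close> cuts \<open>p\<close> off to the left of its zero \<open>t\<close> without losing continuity.
\<close>

lemma truncated_kernel_integral:
  fixes f :: "real \<Rightarrow> real"
  assumes "-1 \<le> t" "t \<le> 1" "poly p t = 0" "continuous_on {-1..1} f"
  shows "integral {-1..1} (\<lambda>s. poly p (max s t) * f s) = integral {t..1} (\<lambda>s. poly p s * f s)"
proof -
  have "integral {-1..t} (\<lambda>s. poly p (max s t) * f s) = integral {-1..t} (\<lambda>s. 0 :: real)"
    by (rule integral_cong) (use assms in auto)
  moreover have "integral {t..1} (\<lambda>s. poly p (max s t) * f s)
      = integral {t..1} (\<lambda>s. poly p s * f s)"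
    by (rule integral_cong) (auto simp: max_def)
  moreover have "(\<lambda>s. poly p (max s t) * f s) integrable_on {-1..1}"
    by (intro integrable_continuous_interval continuous_intros assms)
  ultimately show ?thesis using Henstock_Kurzweil_Integration.integral_combine[OF assms(1,2)] by
      fastforce
qed

theorem theorem4p1:
  fixes L R :: nat and \<theta> :: real and x :: "nat \<Rightarrow> real ^ 3"
    and a :: "nat \<Rightarrow> int \<Rightarrow> complex"
  assumes "1 \<le> L"
    and "0 < \<theta>" "\<theta> \<le> pi"
    and "\<And>k. k \<in> {1..R} \<Longrightarrow> x k \<in> sphere 0 1"
    and "\<And>k l. k \<in> {1..R} \<Longrightarrow> l \<in> {1..R} \<Longrightarrow> k \<noteq> l \<Longrightarrow> x k \<bullet> x l \<le> cos \<theta>"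
  shows "(\<Sum>k=1..R. (cmod (\<Sum>l=0..L. \<Sum>m=-int l..int l. a l m * sph_harm l m (x k)))\<^sup>2)
       \<le> D_const \<theta> L * (\<Sum>l=0..L. \<Sum>m=-int l..int l. (cmod (a l m))\<^sup>2)"
proof -
  obtain t where t: "0 \<le> t" "t < 1" "poly (legendre L) t = 0" "largest_zero L = t"
    and nonneg: "\<And>l s. l \<le> L \<Longrightarrow> t \<le> s \<Longrightarrow> 0 \<le> poly (legendre l) s"
    using largest_zero_dominates[OF assms(1)] by metis
  \<comment> \<open>\<open>P\<^sub>L\<close> cut off to the left of its largest zero\<close>
  define g where "g s = poly (legendre L) (max s t)" for s
  have cg: "continuous_on {-1..1} g" unfolding g_def by (intro continuous_intros)
  define \<gamma> where "\<gamma> l = 2 * pi * integral {-1..1} (\<lambda>s. g s * poly (legendre l) s)" for l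
  have \<gamma>: "\<gamma> l = 2 * pi * integral {t..1} (\<lambda>s. poly (legendre L) s * poly (legendre l) s)" for l
    unfolding \<gamma>_def g_def by (subst truncated_kernel_integral) (use t in \<open>auto
        intro!: continuous_intros\<close>)
  \<comment> \<open>the multiplier of degree \<open>L\<close> is also the squared norm of the kernel, because \<open>g\<^sup>2 = g P\<^sub>L\<close>\<close>
  have \<gamma>_sq: "\<gamma> L = 2 * pi * integral {-1..1} (\<lambda>s. (g s)\<^sup>2)"
  proof -
    have "integral {-1..1} (\<lambda>s. (g s)\<^sup>2) = integral {t..1} (\<lambda>s. poly (legendre L) s * g s)"
      using truncated_kernel_integral[of t "legendre L" g] t cg
          by (simp add: g_def power2_eq_square)
    also have "\<dots> = integral {t..1} (\<lambda>s. poly (legendre L) s * poly (legendre L) s)"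
      by (rule integral_cong) (simp add: g_def max_absorb1)
    finally show ?thesis unfolding \<gamma> by simp
  qed
  have \<gamma>_pos: "0 < \<gamma> L"
  proof -
    let ?f = "\<lambda>s. poly (legendre L) s * poly (legendre L) s"
    have c: "continuous_on {t..1} ?f" by (intro continuous_intros)
    have "0 \<le> integral {t..1} ?f"
        by (rule integral_nonneg) (auto intro!: integrable_continuous_interval c)
    moreover have "integral {t..1} ?f \<noteq> 0"
      using integral_eq_0_iff[OF c t(2)] t(2) by (auto intro!: bexI[of _ 1])
    ultimately show ?thesis unfolding \<gamma> by simp
  qed
  have \<gamma>_min: "\<gamma> L \<le> \<gamma> l" if "l \<le> L" for l
  proof -
    have "poly (legendre L) s * poly (legendre L) s \<le> poly (legendre L) s * poly (legendre l) s"
      if s: "s \<in> {t..1}" for s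
      by (rule mult_left_mono[OF legendre_antimono_degree]) (use s \<open>l \<le> L\<close> nonneg in auto)
    hence "integral {t..1} (\<lambda>s. poly (legendre L) s * poly (legendre L) s)
       \<le> integral {t..1} (\<lambda>s. poly (legendre L) s * poly (legendre l) s)"
      by (intro integral_le integrable_continuous_interval continuous_intros)
    thus ?thesis unfolding \<gamma> by simp
  qed
  define \<omega> where "\<omega> = arccos t"
  have \<omega>: "0 \<le> \<omega>" "\<omega> \<le> pi / 2" "cos \<omega> = t"
    using t arccos_lbound[of t] arccos_le_pi2[of t] by (auto simp: \<omega>_def)
  have c1: "cos (\<theta> / 2) < 1"
    using cos_monotone_0_pi[of 0 "\<theta> / 2"] assms(2,3) by simp
  have c2: "cos (\<theta> / 2 + \<omega>) < 1"
    using cos_monotone_0_pi[of 0 "\<theta> / 2 + \<omega>"] assms(2,3) \<omega> by simp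
  define N where "N = (1 - cos (\<theta> / 2 + \<omega>)) / (1 - cos (\<theta> / 2))"
  have N: "0 < N" using c1 c2 by (simp add: N_def)
  have D: "D_const \<theta> L = N / \<gamma> L"
  proof -
    have "cos (\<theta> / 2 + \<omega>) = cos (\<theta> / 2) * t - sin (\<theta> / 2) * sqrt (1 - t\<^sup>2)"
      using t by (simp add: cos_add \<omega>(3)) (simp add: \<omega>_def sin_arccos)
    hence "1 - cos (\<theta> / 2) * t + sin (\<theta> / 2) * sqrt (1 - t\<^sup>2) = 1 - cos (\<theta> / 2 + \<omega>)" by simp
    moreover have "2 * pi * integral {t..1} (\<lambda>s. (poly (legendre L) s)\<^sup>2) = \<gamma> L"
      unfolding \<gamma> by (simp add: power2_eq_square)
    ultimately show ?thesis unfolding D_const_def t(4) N_def by (simp add: divide_simps)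
  qed
  define H where "H = (SIGMA l:{0..L}. {- int l..int l})"
  have finH: "finite H" by (simp add: H_def)
  have H: "fst p \<le> L" "\<bar>snd p\<bar> \<le> int (fst p)" if "p \<in> H" for p
    using that by (auto simp: H_def)
  let ?Y = "\<lambda>p. sph_harm (fst p) (snd p)" and ?a = "\<lambda>p. a (fst p) (snd p)"
  define S where "S k = (\<Sum>p\<in>H. ?a p * ?Y p (x k))" for k
  define E where "E = (\<Sum>p\<in>H. (cmod (?a p))\<^sup>2)"
  define A where "A = (\<Sum>k=1..R. (cmod (S k))\<^sup>2)"
  define b where "b p = ?a p / of_real (\<gamma> (fst p))" for p
  define T where "T y = (\<Sum>p\<in>H. b p * ?Y p y)" for y
  define h where "h y = (\<Sum>k=1..R. cnj (S k) * of_real (g (x k \<bullet> y)))" for y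
  have cT: "continuous_on (sphere 0 1) T"
    unfolding T_def by (intro continuous_intros continuous_on_sph_harm H(2))
  have cgx: "continuous_on (sphere 0 1) (\<lambda>y. g (x k \<bullet> y))" if "k \<in> {1..R}" for k
    by (rule continuous_on_zonal[OF cg assms(4)[OF that]])
  have ch: "continuous_on (sphere 0 1) h"
    unfolding h_def by (intro continuous_intros cgx)
  have reproduce: "sphere_integral (\<lambda>y. of_real (g (x k \<bullet> y)) * T y) = S k" if k: "k \<in> {1..R}" for k
  proof -
    have "sphere_integral (\<lambda>y. of_real (g (x k \<bullet> y)) * T y)
      = sphere_integral (\<lambda>y. \<Sum>p\<in>H. b p * (of_real (g (x k \<bullet> y)) * ?Y p y))"
      unfolding T_def sum_distrib_left by (simp only: mult_ac)
    also have "\<dots> = (\<Sum>p\<in>H. b p * sphere_integral (\<lambda>y. of_real (g (x k \<bullet> y)) * ?Y p y))"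
    proof (subst sphere_integral_sum)
      show "continuous_on (sphere 0 1) (\<lambda>y. b p * (of_real (g (x k \<bullet> y)) * ?Y p y))"
          if "p \<in> H" for p
        by (intro continuous_intros cgx[OF k] continuous_on_sph_harm H(2)[OF that])
      show "(\<Sum>p\<in>H. sphere_integral (\<lambda>y. b p * (of_real (g (x k \<bullet> y)) * ?Y p y)))
          = (\<Sum>p\<in>H. b p * sphere_integral (\<lambda>y. of_real (g (x k \<bullet> y)) * ?Y p y))"
        by (intro sum.cong refl sphere_integral_mult_left continuous_intros cgx[OF k]
            continuous_on_sph_harm H(2))
    qed
    also have "\<dots> = (\<Sum>p\<in>H. ?a p * ?Y p (x k))"
    proof (intro sum.cong refl)
      fix p assume p: "p \<in> H"
      have "\<gamma> (fst p) \<noteq> 0" using \<gamma>_min[OF H(1)[OF p]] \<gamma>_pos by simp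
      moreover have "sphere_integral (\<lambda>y. of_real (g (x k \<bullet> y)) * ?Y p y)
          = of_real (\<gamma> (fst p)) * ?Y p (x k)"
        unfolding \<gamma>_def by (rule Funk_Hecke[OF H(2)[OF p] assms(4)[OF k] cg])
      ultimately show "b p * sphere_integral (\<lambda>y. of_real (g (x k \<bullet> y)) * ?Y p y)
          = ?a p * ?Y p (x k)"
        by (simp add: b_def)
    qed
    finally show ?thesis unfolding S_def .
  qed
  have hT: "sphere_integral (\<lambda>y. h y * T y) = of_real A"
  proof -
    have "sphere_integral (\<lambda>y. h y * T y)
        = sphere_integral (\<lambda>y. \<Sum>k=1..R. cnj (S k) * (of_real (g (x k \<bullet> y)) * T y))"
      by (simp add: h_def sum_distrib_right mult.assoc)
    also have "\<dots> = (\<Sum>k=1..R. cnj (S k) * S k)"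
    proof (subst sphere_integral_sum)
      show "continuous_on (sphere 0 1) (\<lambda>y. cnj (S k) * (of_real (g (x k \<bullet> y)) * T y))"
          if "k \<in> {1..R}" for k
        by (intro continuous_intros cgx[OF that] cT)
      show "(\<Sum>k=1..R. sphere_integral (\<lambda>y. cnj (S k) * (of_real (g (x k \<bullet> y)) * T y)))
          = (\<Sum>k=1..R. cnj (S k) * S k)"
      proof (intro sum.cong refl)
        fix k assume k: "k \<in> {1..R}"
        show "sphere_integral (\<lambda>y. cnj (S k) * (of_real (g (x k \<bullet> y)) * T y)) = cnj (S k) * S k"
          by (subst sphere_integral_mult_left) (intro continuous_intros cgx[OF k] cT, simp only:
              reproduce[OF k])
      qed
    qed
    also have "\<dots> = of_real A" by (simp only: A_def of_real_sum complex_norm_square mult.commute)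
    finally show ?thesis .
  qed
  have overlap: "(cmod (h y))\<^sup>2 \<le> N * (\<Sum>k=1..R. (cmod (S k))\<^sup>2
      * (g (x k \<bullet> y))\<^sup>2)" if y: "y \<in> sphere 0 1" for y
  proof -
    define K where "K = {k \<in> {1..R}. t < x k \<bullet> y}"
    have "real (card K) * (1 - cos (\<theta> / 2)) \<le> 1 - cos (\<theta> / 2 + \<omega>)"
      by (rule spherical_packing[where x = x and y = y]) (use assms y \<omega> in \<open>auto simp: K_def\<close>)
    hence card: "real (card K) \<le> N" using c1 by (simp add: N_def pos_le_divide_eq)
    have "(cmod (h y))\<^sup>2 \<le> N * (\<Sum>k=1..R. (cmod (cnj (S k) * of_real (g (x k \<bullet> y))))\<^sup>2)"
      unfolding h_def
    proof (rule sum_squared_sparse[OF _ _ _ card])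
      fix k assume "k \<in> {1..R} - K"
      hence "g (x k \<bullet> y) = 0" using t(3) by (auto simp: K_def g_def max_def not_less)
      thus "cnj (S k) * of_real (g (x k \<bullet> y)) = 0" by simp
    qed (auto simp: K_def)
    thus ?thesis by (simp add: norm_mult power_mult_distrib)
  qed
  have Ih: "sphere_integral (\<lambda>y. (cmod (h y))\<^sup>2) \<le> N * A * \<gamma> L"
  proof -
    have cg2: "continuous_on {-1..1} (\<lambda>s. (g s)\<^sup>2)" by (intro continuous_intros cg)
    have "sphere_integral (\<lambda>y. (cmod (h y))\<^sup>2)
        \<le> sphere_integral (\<lambda>y. \<Sum>k=1..R. N * (cmod (S k))\<^sup>2 * (g (x k \<bullet> y))\<^sup>2)"
    proof (rule sphere_integral_mono)
      show "continuous_on (sphere 0 1) (\<lambda>y. (cmod (h y))\<^sup>2)" by (intro continuous_intros ch)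
      show "continuous_on (sphere 0 1) (\<lambda>y. \<Sum>k=1..R. N * (cmod (S k))\<^sup>2 * (g (x k \<bullet> y))\<^sup>2)"
        by (intro continuous_intros cgx)
      show "(cmod (h y))\<^sup>2 \<le> (\<Sum>k=1..R. N * (cmod (S k))\<^sup>2 * (g (x k \<bullet> y))\<^sup>2)"
          if "y \<in> sphere 0 1" for y
        using overlap[OF that] by (simp only: sum_distrib_left mult.assoc)
    qed
    also have "\<dots> = (\<Sum>k=1..R. sphere_integral (\<lambda>y. N * (cmod (S k))\<^sup>2 * (g (x k \<bullet> y))\<^sup>2))"
      by (rule sphere_integral_sum) (intro continuous_intros cgx)
    also have "\<dots> = (\<Sum>k=1..R. N * (cmod (S k))\<^sup>2 * \<gamma> L)"
    proof (intro sum.cong refl)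
      fix k assume k: "k \<in> {1..R}"
      show "sphere_integral (\<lambda>y. N * (cmod (S k))\<^sup>2 * (g (x k \<bullet> y))\<^sup>2) = N * (cmod (S k))\<^sup>2 * \<gamma> L"
        unfolding \<gamma>_sq zonal_integral[OF cg2 assms(4)[OF k], symmetric]
        by (intro sphere_integral_mult_left continuous_intros cgx k)
    qed
    also have "\<dots> = N * A * \<gamma> L" by (simp add: A_def sum_distrib_left sum_distrib_right)
    finally show ?thesis .
  qed
  have IT: "sphere_integral (\<lambda>y. (cmod (T y))\<^sup>2) \<le> E / (\<gamma> L)\<^sup>2"
  proof -
    have "sphere_integral (\<lambda>y. (cmod (T y))\<^sup>2) = (\<Sum>p\<in>H. (cmod (b p))\<^sup>2)"
      unfolding T_def by (rule sph_harm_Parseval[OF finH H(2)])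
    also have "\<dots> \<le> (\<Sum>p\<in>H. (cmod (?a p))\<^sup>2 / (\<gamma> L)\<^sup>2)"
    proof (rule sum_mono)
      fix p assume p: "p \<in> H"
      have "(\<gamma> L)\<^sup>2 \<le> (\<gamma> (fst p))\<^sup>2" using \<gamma>_min[OF H(1)[OF p]] \<gamma>_pos by (intro power_mono) auto
      thus "(cmod (b p))\<^sup>2 \<le> (cmod (?a p))\<^sup>2 / (\<gamma> L)\<^sup>2"
        using \<gamma>_pos by (simp add: b_def norm_divide power_divide frac_le)
    qed
    finally show ?thesis by (simp add: E_def sum_divide_distrib)
  qed
  \<comment> \<open>with this weight the bound for the integral of \<open>\<bar>h\<bar>\<^sup>2\<close> contributes exactly \<open>A / 2\<close>, which is
      absorbed on the left\<close>
  define c where "c = N * \<gamma> L"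
  have c: "0 < c" using N \<gamma>_pos by (simp add: c_def)
  have "A = Re (sphere_integral (\<lambda>y. h y * T y))" by (simp add: hT)
  also have "\<dots> = sphere_integral (\<lambda>y. Re (h y * T y))"
    by (rule sphere_integral_linear[symmetric]) (intro continuous_intros ch cT bounded_linear_Re)+
  also have "\<dots> \<le> sphere_integral (\<lambda>y. 1 / (2 * c) * (cmod (h y))\<^sup>2 + c / 2 * (cmod (T y))\<^sup>2)"
    by (rule sphere_integral_mono)
       (intro continuous_intros ch cT, intro continuous_intros ch cT,
        use Re_mult_le_squares[OF c] in simp)
  also have "\<dots> = 1 / (2 * c) * sphere_integral (\<lambda>y. (cmod (h y))\<^sup>2) + c / 2
      * sphere_integral (\<lambda>y. (cmod (T y))\<^sup>2)"
    by (subst sphere_integral_add, intro continuous_intros ch, intro continuous_intros cT,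
        subst sphere_integral_mult_left, intro continuous_intros ch,
        subst sphere_integral_mult_left, intro continuous_intros cT, rule refl)
  also have "\<dots> \<le> 1 / (2 * c) * (N * A * \<gamma> L) + c / 2 * (E / (\<gamma> L)\<^sup>2)"
    using c Ih IT by (intro add_mono mult_left_mono) auto
  also have "\<dots> = A / 2 + (N / \<gamma> L * E) / 2"
    using N \<gamma>_pos by (simp add: c_def power2_eq_square)
  finally have "A \<le> A / 2 + (N / \<gamma> L * E) / 2" .
  moreover have "A \<le> B" if "A \<le> A / 2 + B / 2" for B using that by simp
  ultimately have "A \<le> N / \<gamma> L * E" by blast
  moreover have "(\<Sum>l=0..L. \<Sum>m=-int l..int l. a l m * sph_harm l m (x k)) = S k" for k
    unfolding S_def H_def by (subst sum.Sigma) (auto simp: case_prod_unfold)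
  moreover have "(\<Sum>l=0..L. \<Sum>m=-int l..int l. (cmod (a l m))\<^sup>2) = E"
    unfolding E_def H_def by (subst sum.Sigma) (auto simp: case_prod_unfold)
  ultimately show ?thesis by (simp add: D A_def)
qed

end
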